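(* Let $M$ be a closed monotone symplectic manifold, and let $e_1,\dots,e_m\in H^*(M;\overline{\mathbb{Q}})[q^{\pm1}]$ be the idempotents giving the maximal decomposition of quantum cohomology over $\overline{\mathbb{Q}}$, i.e. the unique collection, with the largest possible number of members, of nonzero degree $0$ elements satisfying $1=e_1+\cdots+e_m$, $e_i\ast_q e_i=e_i$, and $e_i\ast_q e_j=0$ for $i\neq j$. Then there exists a splitting of $H^*(M;\overline{\mathbb{Q}})[q^{\pm1}][[t]]$ into graded $\overline{\mathbb{Q}}[q^{\pm1}][[t]]$-modules, which is invariant under $\nabla_{tq\partial_q}$, and whose $t=0$ reduction is the splitting of $H^*(M;\overline{\mathbb{Q}})[q^{\pm1}]$ given by quantum product with the $e_i$.
   Context: $q$ and $t$ are formal variables of degree $2$. $\ast_q$ is the small quantum product, $x\ast_q y=\sum_{A\in H_2(M;\mathbb{Z})} q^{\int_A c_1(M)}\, x\ast_A y$, where $\int_M (x\ast_A y)\, z$ is the genus zero three-pointed Gromov-Witten invariant in class $A$. The quantum connection is $\nabla_{tq\partial_q}x = tq\partial_q x + c_1(M)\ast_q x$. $H^*(M;\overline{\mathbb{Q}})[q^{\pm1}][[t]]$ is the graded $t$-completion: degree $d$ elements are $\sum_{k\ge0}x_kt^k$ with $x_k\in H^*(M;\overline{\mathbb{Q}})[q^{\pm1}]$ of degree $d-2k$. With $\tau=t/q$ (degree $0$), this amounts in each fixed degree to a connection over $\overline{\mathbb{Q}}[[\tau]]$. $\overline{\mathbb{Q}}$ is the algebraic closure of $\mathbb{Q}$.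 *)

theory Defs
  imports
    "HOL-Library.Poly_Mapping"
    "HOL-Computational_Algebra.Formal_Power_Series"
    "HOL-Algebra.Algebraic_Closure_Type"
begin

text \<open>
  There is no symplectic geometry in the libraries. A closed monotone symplectic manifold $M$ of
  dimension $2n$ is represented by its cohomology ring over the algebraic closure $K$ of the
  rationals and by its primary genus zero Gromov-Witten invariants. The predicate
  \<open>closed_monotone_symplectic\<close> lists the standard properties of these (Kontsevich-Manin axioms,
  energy and compactness properties, monotonicity). The quantum product, the quantum connection and
  the graded completion are then defined from these data.
\<close>

type_synonym Qbar = "rat alg_closure"

text \<open>Laurent polynomials in $q$ with coefficients in \<open>'a\<close>; exponents are integers.\<close>

type_synonym 'a laurent = "int \<Rightarrow>\<^sub>0 'a"


section \<open>Cohomology and genus zero Gromov-Witten invariants\<close>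

text \<open>
  The type \<open>'v\<close> is $H^*(M;K)$ and the type \<open>'h\<close> is $H_2(M;\mathbb{Z})$.
  The field \<open>gw\<close> gives, for $A$ in $H_2(M;\mathbb{Z})$ and classes $x_1, \ldots, x_k$, the invariant
  $\langle x_1, \ldots, x_k\rangle_A$ obtained by integrating over the space of genus zero stable
  maps in class $A$ with $k$ marked points of arbitrary modulus. It is only meaningful for
  lists of length at least 3.
\<close>

record ('v, 'h) gw_data =
  scal :: "Qbar \<Rightarrow> 'v \<Rightarrow> 'v"
  half_dim :: nat
  coh :: "int \<Rightarrow> 'v set"
  cup :: "'v \<Rightarrow> 'v \<Rightarrow> 'v"
  coh_unit :: 'v
  integ :: "'v \<Rightarrow> Qbar"
  pairing :: "'v \<Rightarrow> 'h \<Rightarrow> Qbar"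
  area :: "'h \<Rightarrow> real"
  chern :: 'v
  chern_num :: "'h \<Rightarrow> int"
  gw :: "'h \<Rightarrow> 'v list \<Rightarrow> Qbar"

text \<open>Cohomology of a closed oriented manifold of dimension $2n$, with the Poincare pairing.\<close>

definition closed_manifold_cohomology ::
  "('v::ab_group_add, 'h::ab_group_add) gw_data \<Rightarrow> bool" where
  "closed_manifold_cohomology M \<longleftrightarrow>
     vector_space (scal M) \<and>
     (\<exists>B. finite B \<and> module.span (scal M) B = UNIV) \<and>
     (\<forall>d. module.subspace (scal M) (coh M d)) \<and>
     (\<forall>d. d < 0 \<or> d > 2 * int (half_dim M) \<longrightarrow> coh M d = {0}) \<and>
     (\<forall>x. \<exists>!c. (\<forall>d. c d \<in> coh M d) \<and> x = (\<Sum>d = 0..2 * int (half_dim M). c d)) \<and>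
     (\<forall>x. Vector_Spaces.linear (scal M) (scal M) (\<lambda>y. cup M x y)) \<and>
     (\<forall>y. Vector_Spaces.linear (scal M) (scal M) (\<lambda>x. cup M x y)) \<and>
     (\<forall>a b. \<forall>x\<in>coh M a. \<forall>y\<in>coh M b. cup M x y \<in> coh M (a + b)) \<and>
     (\<forall>x y z. cup M (cup M x y) z = cup M x (cup M y z)) \<and>
     (\<forall>a b. \<forall>x\<in>coh M a. \<forall>y\<in>coh M b.
        cup M y x = (if odd a \<and> odd b then - cup M x y else cup M x y)) \<and>
     coh_unit M \<in> coh M 0 \<and>
     (\<forall>x. cup M (coh_unit M) x = x) \<and>
     Vector_Spaces.linear (scal M) (*) (integ M) \<and>
     (\<forall>d. d \<noteq> 2 * int (half_dim M) \<longrightarrow> (\<forall>x\<in>coh M d. integ M x = 0)) \<and>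
     (\<forall>x. (\<forall>y. integ M (cup M x y) = 0) \<longrightarrow> x = 0)"

text \<open>
  Pairing of $H^2(M;K)$ with $H_2(M;\mathbb{Z})$, the periods \<open>area\<close> of the symplectic form, and
  the first Chern class with its integer periods \<open>chern_num\<close>. Monotonicity says that
  $c_1(M)$ is a positive multiple of $[\omega]$; both are real classes, so this is a statement about
  periods.
\<close>

definition monotone_classes ::
  "('v::ab_group_add, 'h::ab_group_add) gw_data \<Rightarrow> bool" where
  "monotone_classes M \<longleftrightarrow>
     (\<forall>x\<in>coh M 2. \<forall>y\<in>coh M 2. \<forall>A. pairing M (x + y) A = pairing M x A + pairing M y A) \<and>
     (\<forall>c. \<forall>x\<in>coh M 2. \<forall>A. pairing M (scal M c x) A = c * pairing M x A) \<and>
     (\<forall>x\<in>coh M 2. \<forall>A B. pairing M x (A + B) = pairing M x A + pairing M x B) \<and>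
     (\<forall>x\<in>coh M 2. (\<forall>A. pairing M x A = 0) \<longrightarrow> x = 0) \<and>
     chern M \<in> coh M 2 \<and>
     (\<forall>A. pairing M (chern M) A = of_int (chern_num M A)) \<and>
     (\<forall>A B. area M (A + B) = area M A + area M B) \<and>
     (\<exists>r>0. \<forall>A. of_int (chern_num M A) = r * area M A)"

definition gw_class :: "('v, 'h) gw_data \<Rightarrow> 'h \<Rightarrow> bool" where
  "gw_class M A \<longleftrightarrow> (\<exists>xs. length xs \<ge> 3 \<and> gw M A xs \<noteq> 0)"

text \<open>
  The class $w$ with $\int_M w\, z = \langle x_1, \ldots, x_k, z\rangle_A$ for all $z$; it is unique by
  Poincare duality.
\<close>

definition gw_dual :: "('v, 'h) gw_data \<Rightarrow> 'h \<Rightarrow> 'v list \<Rightarrow> 'v" where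
  "gw_dual M A xs = (THE w. \<forall>z. integ M (cup M w z) = gw M A (xs @ [z]))"

text \<open>
  The conjuncts are, in this order: multilinearity; graded symmetry; the degree (dimension) axiom;
  positivity of energy of nonconstant maps; Gromov compactness; mapping to a point (two parts);
  the fundamental class axiom; the divisor axiom; the splitting axiom.

  The splitting axiom is stated for the relation between the boundary divisors of
  $\overline{M}_{0,4}$ that separate $\{x,y\}$ from $\{z,w\}$, respectively $\{y,z\}$ from $\{x,w\}$, with
  $w$ removed by duality. The four classes $x,y,z,w$ are arbitrary, but the additional insertions
  \<open>S\<close> are only taken of even degree, so that distributing them creates no signs.
\<close>

definition gw_axioms ::
  "('v::ab_group_add, 'h::ab_group_add) gw_data \<Rightarrow> bool" where
  "gw_axioms M \<longleftrightarrow>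
     (\<forall>A xs ys. length xs + length ys \<ge> 2 \<longrightarrow>
        Vector_Spaces.linear (scal M) (*) (\<lambda>x. gw M A (xs @ x # ys))) \<and>
     (\<forall>A xs ys a b. \<forall>x\<in>coh M a. \<forall>y\<in>coh M b. length xs + length ys \<ge> 1 \<longrightarrow>
        gw M A (xs @ y # x # ys) =
          (if odd a \<and> odd b then - gw M A (xs @ x # y # ys) else gw M A (xs @ x # y # ys))) \<and>
     (\<forall>A xs ds. length xs \<ge> 3 \<longrightarrow> list_all2 (\<lambda>x d. x \<in> coh M d) xs ds \<longrightarrow> gw M A xs \<noteq> 0 \<longrightarrow>
        sum_list ds = 2 * int (half_dim M) + 2 * chern_num M A + 2 * (int (length xs) - 3)) \<and>
     (\<forall>A. gw_class M A \<longrightarrow> A = 0 \<or> area M A > 0) \<and>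
     (\<forall>E. finite {A. gw_class M A \<and> area M A \<le> E}) \<and>
     (\<forall>x y z. gw M 0 [x, y, z] = integ M (cup M (cup M x y) z)) \<and>
     (\<forall>xs. length xs > 3 \<longrightarrow> gw M 0 xs = 0) \<and>
     (\<forall>A xs. length xs \<ge> 2 \<longrightarrow> A \<noteq> 0 \<or> length xs \<ge> 3 \<longrightarrow> gw M A (coh_unit M # xs) = 0) \<and>
     (\<forall>A xs. \<forall>D\<in>coh M 2. length xs \<ge> 3 \<longrightarrow> gw M A (D # xs) = pairing M D A * gw M A xs) \<and>
     (\<forall>A x y z S. (\<forall>s\<in>set S. \<exists>d. even d \<and> s \<in> coh M d) \<longrightarrow>
        (\<Sum>B | gw_class M B \<and> gw_class M (A - B). \<Sum>I\<in>Pow {..<length S}.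
           gw_dual M (A - B) (gw_dual M B (x # y # nths S I) # z # nths S (- I))) =
        (\<Sum>B | gw_class M B \<and> gw_class M (A - B). \<Sum>I\<in>Pow {..<length S}.
           gw_dual M (A - B) (x # gw_dual M B (y # z # nths S I) # nths S (- I))))"

definition closed_monotone_symplectic ::
  "('v::ab_group_add, 'h::ab_group_add) gw_data \<Rightarrow> bool" where
  "closed_monotone_symplectic M \<longleftrightarrow>
     closed_manifold_cohomology M \<and> monotone_classes M \<and> gw_axioms M"


section \<open>Small quantum product\<close>

definition qprod_class :: "('v, 'h) gw_data \<Rightarrow> 'h \<Rightarrow> 'v \<Rightarrow> 'v \<Rightarrow> 'v" where
  "qprod_class M A x y = gw_dual M A [x, y]"

text \<open>
  The sum runs over the classes that contribute; there are finitely many, by monotonicity and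
  Gromov compactness. Here the variable $q$ is \<open>Poly_Mapping.single 1\<close>.
\<close>

definition qprod :: "('v::ab_group_add, 'h) gw_data \<Rightarrow> 'v \<Rightarrow> 'v \<Rightarrow> 'v laurent" where
  "qprod M x y = (\<Sum>A | qprod_class M A x y \<noteq> 0.
     Poly_Mapping.single (chern_num M A) (qprod_class M A x y))"

text \<open>
  The $K[q^{\pm 1}]$-bilinear extension; \<open>map_key\<close> precomposes with the given map, so here it
  multiplies by $q^{i+j}$.
\<close>

definition qmult ::
  "('v::ab_group_add, 'h) gw_data \<Rightarrow> 'v laurent \<Rightarrow> 'v laurent \<Rightarrow> 'v laurent" where
  "qmult M x y = (\<Sum>i\<in>Poly_Mapping.keys x. \<Sum>j\<in>Poly_Mapping.keys y.
     Poly_Mapping.map_key (\<lambda>k. k - (i + j))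
       (qprod M (Poly_Mapping.lookup x i) (Poly_Mapping.lookup y j)))"

text \<open>Since $q$ has degree 2, the coefficient of $q^j$ in an element of degree $d$ lies in $H^{d-2j}$.\<close>

definition laurent_deg :: "('v::ab_group_add, 'h) gw_data \<Rightarrow> int \<Rightarrow> 'v laurent set" where
  "laurent_deg M d = {x. \<forall>j. Poly_Mapping.lookup x j \<in> coh M (d - 2 * j)}"

definition idempotent_decomposition ::
  "('v::ab_group_add, 'h) gw_data \<Rightarrow> nat \<Rightarrow> (nat \<Rightarrow> 'v laurent) \<Rightarrow> bool" where
  "idempotent_decomposition M m e \<longleftrightarrow>
     (\<forall>i<m. e i \<in> laurent_deg M 0 \<and> e i \<noteq> 0) \<and>
     (\<Sum>i<m. e i) = Poly_Mapping.single 0 (coh_unit M) \<and>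
     (\<forall>i<m. qmult M (e i) (e i) = e i) \<and>
     (\<forall>i<m. \<forall>j<m. i \<noteq> j \<longrightarrow> qmult M (e i) (e j) = 0)"

definition maximal_idempotent_decomposition ::
  "('v::ab_group_add, 'h) gw_data \<Rightarrow> nat \<Rightarrow> (nat \<Rightarrow> 'v laurent) \<Rightarrow> bool" where
  "maximal_idempotent_decomposition M m e \<longleftrightarrow>
     idempotent_decomposition M m e \<and>
     (\<forall>m' e'. idempotent_decomposition M m' e' \<longrightarrow> m' \<le> m)"


section \<open>Graded completion and quantum connection\<close>

text \<open>
  Power series in $t$ are \<open>fps\<close>. The graded completion is the set of finite sums of homogeneous
  elements, not the whole type.
\<close>

definition graded_sum :: "(int \<Rightarrow> 'a::comm_monoid_add set) \<Rightarrow> 'a set" where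
  "graded_sum G = {x. \<exists>D y. finite D \<and> (\<forall>d\<in>D. y d \<in> G d) \<and> x = (\<Sum>d\<in>D. y d)}"

definition completion_deg ::
  "('v::ab_group_add, 'h) gw_data \<Rightarrow> int \<Rightarrow> 'v laurent fps set" where
  "completion_deg M d = {x. \<forall>k. fps_nth x k \<in> laurent_deg M (d - 2 * int k)}"

definition completion :: "('v::ab_group_add, 'h) gw_data \<Rightarrow> 'v laurent fps set" where
  "completion M = graded_sum (completion_deg M)"

text \<open>The coefficient ring $K[q^{\pm 1}][[t]]$, again with $q$ and $t$ of degree 2.\<close>

definition coeff_deg :: "int \<Rightarrow> Qbar laurent fps set" where
  "coeff_deg d = {r. \<forall>k. \<forall>j\<in>Poly_Mapping.keys (fps_nth r k). 2 * j + 2 * int k = d}"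

definition coeff_ring :: "Qbar laurent fps set" where
  "coeff_ring = graded_sum coeff_deg"

definition laurent_scale ::
  "('v::ab_group_add, 'h) gw_data \<Rightarrow> Qbar laurent \<Rightarrow> 'v laurent \<Rightarrow> 'v laurent" where
  "laurent_scale M a x = (\<Sum>i\<in>Poly_Mapping.keys a. \<Sum>j\<in>Poly_Mapping.keys x.
     Poly_Mapping.single (i + j) (scal M (Poly_Mapping.lookup a i) (Poly_Mapping.lookup x j)))"

definition completion_scale ::
  "('v::ab_group_add, 'h) gw_data \<Rightarrow> Qbar laurent fps \<Rightarrow> 'v laurent fps \<Rightarrow> 'v laurent fps" where
  "completion_scale M r x =
     Abs_fps (\<lambda>k. \<Sum>i\<le>k. laurent_scale M (fps_nth r i) (fps_nth x (k - i)))"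

definition q_deriv :: "('v::ab_group_add, 'h) gw_data \<Rightarrow> 'v laurent \<Rightarrow> 'v laurent" where
  "q_deriv M x = (\<Sum>j\<in>Poly_Mapping.keys x.
     Poly_Mapping.single j (scal M (of_int j) (Poly_Mapping.lookup x j)))"

text \<open>The operator $\nabla_{tq\partial_q} x = tq\partial_q x + c_1(M) \ast_q x$, coefficientwise in $t$.\<close>

definition quantum_connection ::
  "('v::ab_group_add, 'h) gw_data \<Rightarrow> 'v laurent fps \<Rightarrow> 'v laurent fps" where
  "quantum_connection M x = Abs_fps (\<lambda>k.
     (if k = 0 then 0 else q_deriv M (fps_nth x (k - 1))) +
     qmult M (Poly_Mapping.single 0 (chern M)) (fps_nth x k))"

definition graded_submodule ::
  "('v::ab_group_add, 'h) gw_data \<Rightarrow> 'v laurent fps set \<Rightarrow> bool" where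
  "graded_submodule M W \<longleftrightarrow>
     0 \<in> W \<and>
     (\<forall>x\<in>W. \<forall>y\<in>W. x + y \<in> W) \<and>
     (\<forall>r\<in>coeff_ring. \<forall>x\<in>W. completion_scale M r x \<in> W) \<and>
     W = graded_sum (\<lambda>d. W \<inter> completion_deg M d)"

text \<open>Internal direct sum decompositions of the completion; \<open>W i\<close> and \<open>w i\<close> matter only for $i < m$.\<close>

definition graded_splitting ::
  "('v::ab_group_add, 'h) gw_data \<Rightarrow> nat \<Rightarrow> (nat \<Rightarrow> 'v laurent fps set) \<Rightarrow> bool" where
  "graded_splitting M m W \<longleftrightarrow>
     (\<forall>i<m. graded_submodule M (W i)) \<and>
     (\<forall>x\<in>completion M. \<exists>!w. (\<forall>i<m. w i \<in> W i) \<and> (\<forall>i\<ge>m. w i = 0) \<and> x = (\<Sum>i<m. w i))"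

end

theory Submission
  imports Defs
begin

text \<open>
The splitting cannot be read off from \<^term>\<open>quantum_connection M\<close> alone: multiplication by $c_1(M)$ may have
the same eigenvalue on two different summands $e_i \ast_q H$, and then the usual formal decomposition
by eigenvalues does not separate them. The idea is to extend the connection to a flat connection in
one more variable, in whose direction the eigenvalues do differ.

Fix one idempotent $e$. Write $x \ast_{se} y$ for the quantum product deformed by inserting the bulk class
$s e$, where $s$ is a formal variable; its coefficient of $s^l$ is the product with $l$
further insertions of $e$, divided by $l!$. Let $A(s)$ be the operator $e \ast_{se}$, and
$T(s) = t q\partial_q + (c_1(M) + s\, q\partial_q e) \ast_{se}$. Then $t\partial_s + A(s)$ and $T(s)$ commute.
The part of this identity without $t$ says that two product operators commute, which is the
splitting axiom with graded symmetry (\<open>wdvv\<close>, \<open>mult_op_commute\<close>); the part linear in $t$ is the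
divisor axiom (\<open>qprod_taylor_divisor\<close>). At $s = 0$ the operator $T$ is the quantum connection.

Now $A(0)$ is an idempotent, so its only eigenvalues are $0$ and $1$, and $t\partial_s + A(s)$ preserves the
image of an idempotent series $U(s,t)$ with $U(0,0) = A(0)$. It comes from a fixed point equation that is contracting
if $s$ has weight 1 and $t$ has weight 2 (\<open>idempotent_deformation\<close>). Flatness turns the
obstruction to $T$ preserving the image of $U$ into the solution of a homogeneous equation of the same
contracting kind, so it vanishes (\<open>deformed_idempotent_invariant\<close>). Setting $s = 0$ gives a
projector $P = U(0,t)$ whose image is invariant under the quantum connection and whose reduction at
$t = 0$ is $e \ast_q$ (\<open>flat_projector\<close>).

Doing this separately for each $e_i$ gives projectors $P_i$, and $W_i$ is the image of $P_i$. The $P_i$ come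
from different families, and nothing is claimed about their products. But the sum of the $P_i$ is the
identity at $t = 0$, hence invertible, so the $W_i$ span; and a relation between elements of the $W_i$ is
excluded by looking at its lowest coefficient in $t$, where the $e_i$ are orthogonal
(\<open>invariant_splitting\<close>).
\<close>

section \<open>Flat deformations of an idempotent\<close>

text \<open>
The operator $t\partial_s$. In a double series \<open>F\<close>, the coefficient \<^term>\<open>F $ l $ k\<close> belongs to $s^l t^k$:
the outer variable is $s$, so that \<^term>\<open>F $ 0\<close> is the value at $s = 0$.
\<close>

definition t_deriv_s :: "'a::ring_1 fps fps \<Rightarrow> 'a fps fps" where
  "t_deriv_s F = fps_const fps_X * fps_deriv F"

lemma t_deriv_s_nth:
  "t_deriv_s F $ l $ k = (if k = 0 then 0 else of_nat (Suc l) * F $ Suc l $ (k - 1))"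
  by (simp add: t_deriv_s_def fps_of_nat [symmetric] del: of_nat_Suc)

lemma t_deriv_s_add: "t_deriv_s (F + G) = t_deriv_s F + t_deriv_s G"
  and t_deriv_s_diff: "t_deriv_s (F - G) = t_deriv_s F - t_deriv_s G"
  by (simp_all add: t_deriv_s_def algebra_simps)

lemma t_deriv_s_const [simp]: "t_deriv_s (fps_const c) = 0"
  by (simp add: t_deriv_s_def)

lemma t_deriv_s_0 [simp]: "t_deriv_s 0 = 0"
  by (simp add: t_deriv_s_def)

lemma t_deriv_s_mult: "t_deriv_s (F * G) = t_deriv_s F * G + F * t_deriv_s G"
proof -
  have "fps_const fps_X * F = F * fps_const fps_X" for F :: "'a fps fps"
    by (rule fps_ext) (simp add: fps_mult_fps_X_commute)
  then have "fps_const fps_X * (F * H) = F * (fps_const fps_X * H)" for H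
    by (metis mult.assoc)
  then show ?thesis
    by (simp add: t_deriv_s_def algebra_simps)
qed

text \<open>
The filtration in which $s$ has weight 1 and $t$ has weight 2. With these weights, $t\partial_s$ and
multiplication by a series without $s^0$ term both raise the weight, although the first
of them lowers the order in $s$.
\<close>

definition vanishes_below :: "nat \<Rightarrow> 'a::zero fps fps \<Rightarrow> bool" where
  "vanishes_below n F \<longleftrightarrow> (\<forall>l k. l + 2 * k < n \<longrightarrow> F $ l $ k = 0)"

lemma vanishes_below_0 [simp]: "vanishes_below 0 F"
  by (simp add: vanishes_below_def)

lemma vanishes_below_add:
  "vanishes_below n F \<Longrightarrow> vanishes_below n G \<Longrightarrow> vanishes_below n (F + G :: 'a::ring_1 fps fps)"
  by (simp add: vanishes_below_def)

lemma vanishes_below_diff: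
  "vanishes_below n F \<Longrightarrow> vanishes_below n G \<Longrightarrow> vanishes_below n (F - G :: 'a::ring_1 fps fps)"
  by (simp add: vanishes_below_def)

lemma vanishes_below_mono: "vanishes_below n F \<Longrightarrow> m \<le> n \<Longrightarrow> vanishes_below m F"
  by (simp add: vanishes_below_def)

lemma nth_mult2:
  "(F * G :: 'a::ring_1 fps fps) $ l $ k = (\<Sum>i=0..l. \<Sum>j=0..k. F $ i $ j * G $ (l - i) $ (k - j))"
  by (simp add: fps_mult_nth fps_sum_nth)

lemma vanishes_below_mult:
  fixes F G :: "'a::ring_1 fps fps"
  assumes "vanishes_below m F" "vanishes_below n G"
  shows "vanishes_below (m + n) (F * G)"
  unfolding vanishes_below_def
proof (intro allI impI)
  fix l k :: nat
  assume *: "l + 2 * k < m + n"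
  have "F $ i $ j * G $ (l - i) $ (k - j) = 0" if "i \<le> l" "j \<le> k" for i j
  proof -
    have "i + 2 * j < m \<or> (l - i) + 2 * (k - j) < n"
      using * that by linarith
    then show ?thesis
      using assms by (auto simp: vanishes_below_def)
  qed
  then show "(F * G) $ l $ k = 0"
    by (simp add: nth_mult2)
qed

lemma vanishes_below_t_deriv_s:
  "vanishes_below n F \<Longrightarrow> vanishes_below (Suc n) (t_deriv_s F)"
  by (auto simp: vanishes_below_def t_deriv_s_nth)

lemma eq_0_if_vanishes_below: "(\<And>n. vanishes_below n F) \<Longrightarrow> F = 0"
  unfolding vanishes_below_def by (metis fps_ext fps_zero_nth lessI)

text \<open>
The iterates of $0$ stabilise in each weight. The sets \<open>C l k\<close> carry along any
condition on individual coefficients, since a coefficient of the limit is a coefficient of an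
iterate.
\<close>

lemma contraction_fixed_point:
  fixes \<Phi> :: "'a::ring_1 fps fps \<Rightarrow> 'a fps fps"
  assumes contr: "\<And>n F G. vanishes_below n (F - G) \<Longrightarrow> vanishes_below (Suc n) (\<Phi> F - \<Phi> G)"
    and zero: "\<And>l k. 0 \<in> C l k"
    and pres: "\<And>F. (\<And>l k. F $ l $ k \<in> C l k) \<Longrightarrow> (\<And>l k. \<Phi> F $ l $ k \<in> C l k)"
  obtains F where "\<Phi> F = F" "\<And>l k. F $ l $ k \<in> C l k"
proof -
  define f where "f n = (\<Phi> ^^ n) 0" for n
  have f_Suc: "f (Suc n) = \<Phi> (f n)" for n by (simp add: f_def)
  have step: "vanishes_below n (f (Suc n) - f n)" for n
    by (induction n) (simp_all add: f_Suc contr)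
  have stab: "vanishes_below n (f (n + d) - f n)" for n d
  proof (induction d)
    case (Suc d)
    have "vanishes_below n (f (Suc (n + d)) - f (n + d))"
      using step vanishes_below_mono le_add1 by blast
    from vanishes_below_add [OF this Suc] show ?case by simp
  qed (simp add: vanishes_below_def)
  define F where "F = Abs_fps (\<lambda>l. Abs_fps (\<lambda>k. f (Suc (l + 2 * k)) $ l $ k))"
  have near: "vanishes_below n (F - f n)" for n
    unfolding vanishes_below_def
  proof (intro allI impI)
    fix l k :: nat
    assume "l + 2 * k < n"
    then obtain d where "n = Suc (l + 2 * k) + d"
      using less_iff_Suc_add by auto
    with stab [of "Suc (l + 2 * k)" d] show "(F - f n) $ l $ k = 0"
      by (simp add: vanishes_below_def F_def)
  qed
  have "\<Phi> F - F = 0"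
  proof (rule eq_0_if_vanishes_below)
    fix n
    have "vanishes_below n (\<Phi> F - f (Suc n))"
      unfolding f_Suc using contr [OF near] vanishes_below_mono le_SucI by blast
    moreover have "vanishes_below n (F - f (Suc n))"
      using near vanishes_below_mono le_SucI by blast
    ultimately have "vanishes_below n ((\<Phi> F - f (Suc n)) - (F - f (Suc n)))"
      by (rule vanishes_below_diff)
    then show "vanishes_below n (\<Phi> F - F)"
      by simp
  qed
  moreover have "f n $ l $ k \<in> C l k" for n l k
    by (induction n arbitrary: l k) (simp_all add: f_def zero pres)
  then have "F $ l $ k \<in> C l k" for l k
    by (simp add: F_def)
  ultimately show thesis
    using that [of F] by simp
qed

text \<open>
The coefficient of $s^l t^k$ in the deformed idempotent will have to lie in degree \<open>l + k\<close> of a graded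
subring of operators: those that are linear over the coefficients and lower degrees by twice that
amount.
\<close>

locale graded_subring =
  fixes S :: "nat \<Rightarrow> 'a::ring_1 set"
  assumes zero_in: "0 \<in> S n"
    and diff_in: "x \<in> S n \<Longrightarrow> y \<in> S n \<Longrightarrow> x - y \<in> S n"
    and one_in: "1 \<in> S 0"
    and mult_in: "x \<in> S m \<Longrightarrow> y \<in> S n \<Longrightarrow> x * y \<in> S (m + n)"
begin

lemma uminus_in: "x \<in> S n \<Longrightarrow> - x \<in> S n"
  using diff_in [OF zero_in] by fastforce

lemma add_in: "x \<in> S n \<Longrightarrow> y \<in> S n \<Longrightarrow> x + y \<in> S n"
  using diff_in uminus_in by fastforce

lemma sum_in: "(\<And>i. i \<in> I \<Longrightarrow> f i \<in> S n) \<Longrightarrow> sum f I \<in> S n"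
  by (induction I rule: infinite_finite_induct) (auto simp: zero_in add_in)

lemma of_nat_mult_in: "x \<in> S n \<Longrightarrow> of_nat i * x \<in> S n"
  by (induction i) (auto simp: zero_in add_in algebra_simps)

definition homogeneous :: "'a fps fps \<Rightarrow> bool" where
  "homogeneous F \<longleftrightarrow> (\<forall>l k. F $ l $ k \<in> S (l + k))"

lemma homogeneous_add: "homogeneous F \<Longrightarrow> homogeneous G \<Longrightarrow> homogeneous (F + G)"
  and homogeneous_diff: "homogeneous F \<Longrightarrow> homogeneous G \<Longrightarrow> homogeneous (F - G)"
  by (simp_all add: homogeneous_def add_in diff_in)

lemma homogeneous_const: "x \<in> S 0 \<Longrightarrow> homogeneous (fps_const (fps_const x))"
  by (simp add: homogeneous_def fps_const_def zero_in)

lemma homogeneous_mult: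
  assumes "homogeneous F" "homogeneous G"
  shows "homogeneous (F * G)"
proof -
  have "F $ i $ j * G $ (l - i) $ (k - j) \<in> S (l + k)" if "i \<le> l" "j \<le> k" for i j l k
  proof -
    have "F $ i $ j * G $ (l - i) $ (k - j) \<in> S ((i + j) + ((l - i) + (k - j)))"
      using assms unfolding homogeneous_def by (intro mult_in) blast+
    moreover have "(i + j) + ((l - i) + (k - j)) = l + k"
      using that by simp
    ultimately show ?thesis by simp
  qed
  then show ?thesis
    by (auto simp: homogeneous_def nth_mult2 intro!: sum_in)
qed

lemma homogeneous_t_deriv_s: "homogeneous F \<Longrightarrow> homogeneous (t_deriv_s F)"
proof -
  assume F: "homogeneous F"
  have "of_nat (Suc l) * F $ Suc l $ (k - 1) \<in> S (l + k)" if "k \<noteq> 0" for l k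
  proof -
    have "F $ Suc l $ (k - 1) \<in> S (Suc l + (k - 1))"
      using F unfolding homogeneous_def by blast
    moreover have "Suc l + (k - 1) = l + k"
      using that by simp
    ultimately show ?thesis
      using of_nat_mult_in by metis
  qed
  then show ?thesis
    by (simp add: homogeneous_def t_deriv_s_nth zero_in)
qed

text \<open>
Write $U = e + g$ and look for the invariant submodule as a graph over the image of $e$, that is, with
$g = (1-e) g e$. Invariance of the image of $U$ under $t\partial_s + e + a$ is then the Riccati equation
$g = t\partial_s g + a U - U a U$. Its linear term $g$ on the left has coefficient 1 because the
eigenvalues of $e$ on the two summands differ by 1; this is what makes the equation contracting.
\<close>

lemma idempotent_deformation:
  assumes e: "e * e = e" "e \<in> S 0" and a: "homogeneous a" "a $ 0 = 0"
  defines "E \<equiv> fps_const (fps_const e)"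
  obtains U where "homogeneous U" "U $ 0 $ 0 = e" "U * E = U" "E * U = E"
    "t_deriv_s U + (E + a) * U = U * (E + a) * U"
proof -
  define \<Phi> where "\<Phi> g = t_deriv_s g + a * (E + g) - (E + g) * a * (E + g)" for g
  define C where "C l k = {x \<in> S (l + k). x * e = x \<and> e * x = 0}" for l k
  have EE: "E * E = E" by (simp add: E_def e)
  have tE [simp]: "t_deriv_s E = 0" by (simp add: E_def)
  have C_iff: "(\<forall>l k. g $ l $ k \<in> C l k) \<longleftrightarrow> homogeneous g \<and> g * E = g \<and> E * g = 0" for g
    by (auto simp: C_def homogeneous_def E_def fps_eq_iff)
  have va: "vanishes_below 1 a"
    using a by (auto simp: vanishes_below_def)
  have contr: "vanishes_below (Suc n) (\<Phi> F - \<Phi> G)" if FG: "vanishes_below n (F - G)" for n F G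
  proof -
    have eq: "\<Phi> F - \<Phi> G = t_deriv_s (F - G) + a * (F - G) - (F - G) * a * (E + F)
        - (E + G) * a * (F - G)"
      by (simp add: \<Phi>_def t_deriv_s_diff algebra_simps)
    have v1: "vanishes_below (Suc n) (a * (F - G))"
      using vanishes_below_mult [OF va FG] by simp
    have v2: "vanishes_below (Suc n) ((F - G) * a * (E + F))"
      using vanishes_below_mult [OF vanishes_below_mult [OF FG va] vanishes_below_0] by simp
    have v3: "vanishes_below (Suc n) ((E + G) * a * (F - G))"
      using vanishes_below_mult [OF vanishes_below_0 [of "E + G"] v1] by (simp add: mult.assoc)
    show ?thesis
      unfolding eq
      by (intro vanishes_below_diff vanishes_below_add vanishes_below_t_deriv_s FG v1 v2 v3)
  qed
  have zero: "0 \<in> C l k" for l k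
    by (simp add: C_def zero_in)
  have pres: "\<Phi> g $ l $ k \<in> C l k" if g: "\<And>l k. g $ l $ k \<in> C l k" for g l k
  proof -
    have g': "homogeneous g" "g * E = g" "E * g = 0"
      using C_iff [of g] g by auto
    have "homogeneous (\<Phi> g)"
      unfolding \<Phi>_def
      by (intro homogeneous_add homogeneous_diff homogeneous_mult homogeneous_t_deriv_s g' a)
        (simp_all add: E_def homogeneous_const e)
    moreover have "t_deriv_s g * E = t_deriv_s g"
      using t_deriv_s_mult [of g E] g' by simp
    then have "\<Phi> g * E = \<Phi> g"
      using g' by (simp add: \<Phi>_def algebra_simps EE)
    moreover have "E * t_deriv_s g = 0"
      using t_deriv_s_mult [of E g] g' by simp
    then have "E * \<Phi> g = 0"
    proof -
      have "E * ((E + g) * a * (E + g)) = (E * (E + g)) * a * (E + g)"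
        by (simp only: mult.assoc)
      also have "E * (E + g) = E"
        using g' by (simp add: algebra_simps EE)
      finally show ?thesis
        using \<open>E * t_deriv_s g = 0\<close> by (simp add: \<Phi>_def distrib_left right_diff_distrib mult.assoc)
    qed
    ultimately show ?thesis
      using C_iff [of "\<Phi> g"] by blast
  qed
  obtain g where fix_g: "\<Phi> g = g" and gC: "\<And>l k. g $ l $ k \<in> C l k"
    using contraction_fixed_point [of \<Phi> C, OF contr zero pres] by blast
  have g: "homogeneous g" "g * E = g" "E * g = 0"
    using C_iff [of g] gC by auto
  define U where "U = E + g"
  have UE: "U * E = U" and EU: "E * U = E"
    by (simp_all add: U_def g algebra_simps EE)
  have UU: "U * U = U"
    by (metis UE EU mult.assoc)
  have "g $ 0 $ 0 = 0"
    using arg_cong [OF fix_g, of "\<lambda>F. F $ 0 $ 0"] by (simp add: \<Phi>_def t_deriv_s_nth a)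
  then have "U $ 0 $ 0 = e"
    by (simp add: U_def E_def)
  moreover have "homogeneous U"
    by (simp add: U_def homogeneous_add g E_def homogeneous_const e)
  moreover have "t_deriv_s U + (E + a) * U = U * (E + a) * U"
  proof -
    have "t_deriv_s g = \<Phi> g - a * U + U * a * U"
      by (simp add: \<Phi>_def U_def)
    then have "t_deriv_s U = g - a * U + U * a * U"
      by (simp add: fix_g U_def t_deriv_s_add)
    moreover have "(E + a) * U = E + a * U" and "U * (E + a) * U = U + U * a * U"
      by (simp_all add: distrib_left distrib_right EU UE UU)
    ultimately show ?thesis
      by (simp add: U_def)
  qed
  ultimately show thesis
    using that UE EU by blast
qed

end

text \<open>
The obstruction $Q = (1-U) T U$ satisfies a linear differential equation by flatness. Rewritten with the
relations between $U$ and $E$, it becomes $Q = t\partial_s Q - Q a U + a Q - U a Q$, whose right hand side has larger weight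
than $Q$.
\<close>

lemma deformed_idempotent_invariant:
  fixes U a T :: "'a::ring_1 fps fps"
  assumes UE: "U * E = U" and EU: "E * U = E" and a: "a $ 0 = 0"
    and U: "t_deriv_s U + (E + a) * U = U * (E + a) * U"
    and T: "t_deriv_s T + (E + a) * T = T * (E + a)"
  shows "T * U = U * T * U"
proof -
  define A where "A = E + a"
  define Q where "Q = T * U - U * T * U"
  have UU: "U * U = U"
    by (metis UE EU mult.assoc)
  have dU: "t_deriv_s U = U * A * U - A * U" and dT: "t_deriv_s T = T * A - A * T"
    using U T by (simp_all add: A_def eq_diff_eq)
  have "t_deriv_s Q = Q * A * U - A * Q + U * A * Q"
    by (simp add: Q_def t_deriv_s_diff t_deriv_s_mult dU dT algebra_simps)
  moreover have "Q * E = Q"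
    by (simp add: Q_def left_diff_distrib mult.assoc UE)
  then have "Q * E * U = Q" and "Q * U = Q"
    by (metis EU mult.assoc)+
  moreover have "U * Q = 0"
    by (simp add: Q_def right_diff_distrib mult.assoc [symmetric] UU)
  moreover have "E * Q = 0"
    by (simp add: Q_def right_diff_distrib mult.assoc [symmetric] EU)
  ultimately have Q_eq: "Q = t_deriv_s Q - Q * a * U + a * Q - U * a * Q"
    by (simp add: A_def distrib_left distrib_right UE)
  have va: "vanishes_below 1 a"
    using a by (auto simp: vanishes_below_def)
  have "vanishes_below n Q" for n
  proof (induction n)
    case (Suc n)
    have v1: "vanishes_below (Suc n) (a * Q)"
      using vanishes_below_mult [OF va Suc] by simp
    have v2: "vanishes_below (Suc n) (Q * a * U)"
      using vanishes_below_mult [OF vanishes_below_mult [OF Suc va] vanishes_below_0] by simp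
    have v3: "vanishes_below (Suc n) (U * a * Q)"
      using vanishes_below_mult [OF vanishes_below_0 [of U] v1] by (simp add: mult.assoc)
    show ?case
      by (subst Q_eq) (intro vanishes_below_diff vanishes_below_add vanishes_below_t_deriv_s Suc v1 v2 v3)
  qed simp
  then have "Q = 0"
    by (rule eq_0_if_vanishes_below)
  then show ?thesis
    by (simp add: Q_def)
qed

text \<open>
Series in $s$, seen as double series that do not involve $t$.
\<close>

definition const_t :: "'a::ring_1 fps \<Rightarrow> 'a fps fps" where
  "const_t F = Abs_fps (\<lambda>l. fps_const (F $ l))"

lemma const_t_nth: "const_t F $ l = fps_const (F $ l)"
  by (simp add: const_t_def)

lemma const_t_add: "const_t (F + G) = const_t F + const_t G"
  and const_t_mult: "const_t (F * G) = const_t F * const_t G"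
  and const_t_const: "const_t (fps_const x) = fps_const (fps_const x)"
proof -
  show "const_t (F + G) = const_t F + const_t G"
    by (rule fps_ext) (simp add: const_t_nth)
  show "const_t (F * G) = const_t F * const_t G"
  proof (rule fps_ext)
    fix l
    have *: "fps_const (sum h I) = (\<Sum>i\<in>I. fps_const (h i))" for h :: "nat \<Rightarrow> 'a" and I
      by (induction I rule: infinite_finite_induct) (auto simp: fps_const_add [symmetric] simp del: fps_const_add)
    show "const_t (F * G) $ l = (const_t F * const_t G) $ l"
      by (simp add: const_t_nth fps_mult_nth *)
  qed
  show "const_t (fps_const x) = fps_const (fps_const x)"
    by (rule fps_ext, rule fps_ext) (simp add: const_t_nth)
qed

lemma t_deriv_s_const_t: "t_deriv_s (const_t F) = fps_const fps_X * const_t (fps_deriv F)"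
proof -
  have "fps_deriv (const_t F) = const_t (fps_deriv F)"
    by (rule fps_ext) (simp add: const_t_nth fps_of_nat [symmetric] del: of_nat_Suc)
  then show ?thesis
    by (simp add: t_deriv_s_def)
qed

text \<open>
The two hypotheses are the coefficients of $t^0$ and $t^1$ in the commutator of $t\partial_s + F$ and
$G + t d$.
\<close>

lemma flatness_from_coefficients:
  fixes F G :: "'a::ring_1 fps" and d :: 'a
  assumes comm: "F * G = G * F" and div: "fps_deriv G + F * fps_const d = fps_const d * F"
  defines "T \<equiv> const_t G + fps_const (fps_X * fps_const d)"
  shows "t_deriv_s T + const_t F * T = T * const_t F"
proof -
  have X: "H * fps_const fps_X = fps_const fps_X * H" for H :: "'a fps fps"
    by (rule fps_ext) (simp add: fps_mult_fps_X_commute)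
  have T: "T = const_t G + fps_const fps_X * const_t (fps_const d)"
    by (simp add: T_def const_t_const)
  have "const_t F * (fps_const fps_X * const_t (fps_const d)) = fps_const fps_X * const_t (F * fps_const d)"
    by (simp only: const_t_mult mult.assoc [symmetric] X)
  moreover have "fps_const fps_X * const_t (fps_const d) * const_t F = fps_const fps_X * const_t (fps_const d * F)"
    by (simp add: const_t_mult mult.assoc)
  moreover have "t_deriv_s T = fps_const fps_X * const_t (fps_deriv G)"
    by (simp add: T_def t_deriv_s_add t_deriv_s_const_t)
  moreover have "const_t F * const_t G = const_t G * const_t F"
    by (simp only: const_t_mult [symmetric] comm)
  moreover have "fps_const fps_X * const_t (fps_deriv G) + fps_const fps_X * const_t (F * fps_const d)
      = fps_const fps_X * const_t (fps_const d * F)"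
    by (simp only: distrib_left [symmetric] const_t_add [symmetric] div)
  ultimately show ?thesis
    unfolding T by (simp only: distrib_left distrib_right) (simp add: algebra_simps)
qed

section \<open>Additive endomorphisms and their power series\<close>

text \<open>
The ring of additive endomorphisms, with a copy of the integers as a direct factor. The factor
keeps \<open>0 \<noteq> 1\<close> true when the group is trivial, as the class of rings with unit demands. Operators
made from a function have second component 0.
\<close>

typedef (overloaded) 'a endo =
  "{(f :: 'a::ab_group_add \<Rightarrow> 'a, n :: int). \<forall>x y. f (x + y) = f x + f y}"
  by (intro exI [of _ "(\<lambda>_. 0, 0)"]) simp

setup_lifting type_definition_endo

lift_definition app :: "'a::ab_group_add endo \<Rightarrow> 'a \<Rightarrow> 'a" is fst .
lift_definition int_part :: "'a::ab_group_add endo \<Rightarrow> int" is snd .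

lemma endo_eqI: "(\<And>x. app f x = app g x) \<Longrightarrow> int_part f = int_part g \<Longrightarrow> f = g"
  by transfer (auto intro: prod_eqI)

lemma app_add: "app f (x + y) = app f x + app f y"
  by transfer auto

lemma app_0 [simp]: "app f 0 = 0"
  using app_add [of f 0 0] by simp

lemma app_sum: "app f (sum g I) = (\<Sum>i\<in>I. app f (g i))"
  by (induction I rule: infinite_finite_induct) (auto simp: app_add)

lift_definition endo_of :: "('a::ab_group_add \<Rightarrow> 'a) \<Rightarrow> 'a endo" is
  "\<lambda>f. (if \<forall>x y. f (x + y) = f x + f y then f else (\<lambda>_. 0), 0)"
  by auto

lemma app_endo_of: "(\<And>x y. f (x + y) = f x + f y) \<Longrightarrow> app (endo_of f) = f"
  by transfer auto

lemma int_part_endo_of [simp]: "int_part (endo_of f) = 0"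
  by transfer auto

instantiation endo :: (ab_group_add) ring_1
begin

lift_definition zero_endo :: "'a endo" is "(\<lambda>_. 0, 0)" by simp
lift_definition one_endo :: "'a endo" is "(\<lambda>x. x, 1)" by simp
lift_definition plus_endo :: "'a endo \<Rightarrow> 'a endo \<Rightarrow> 'a endo" is
  "\<lambda>f g. (\<lambda>x. fst f x + fst g x, snd f + snd g)"
  by (auto simp: algebra_simps)
lift_definition minus_endo :: "'a endo \<Rightarrow> 'a endo \<Rightarrow> 'a endo" is
  "\<lambda>f g. (\<lambda>x. fst f x - fst g x, snd f - snd g)"
  by (auto simp: algebra_simps)
lift_definition uminus_endo :: "'a endo \<Rightarrow> 'a endo" is
  "\<lambda>f. (\<lambda>x. - fst f x, - snd f)"
  by (auto simp: algebra_simps)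
lift_definition times_endo :: "'a endo \<Rightarrow> 'a endo \<Rightarrow> 'a endo" is
  "\<lambda>f g. (\<lambda>x. fst f (fst g x), snd f * snd g)"
  by (auto simp: algebra_simps)

instance
  by standard (transfer; auto simp: algebra_simps intro!: ext)+

end

lemma app_zero [simp]: "app 0 x = 0"
  and app_one [simp]: "app 1 x = x"
  and app_plus: "app (f + g) x = app f x + app g x"
  and app_minus: "app (f - g) x = app f x - app g x"
  and app_times: "app (f * g) x = app f (app g x)"
  by (transfer; simp)+

lemma int_part_simps [simp]:
  "int_part 0 = 0" "int_part 1 = 1" "int_part (f + g) = int_part f + int_part g"
  "int_part (f * g) = int_part f * int_part g"
  by (transfer; simp)+

lemma app_fun_sum: "app (sum f I) x = (\<Sum>i\<in>I. app (f i) x)"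
  by (induction I rule: infinite_finite_induct) (auto simp: app_plus)

lemma int_part_sum: "int_part (sum f I) = (\<Sum>i\<in>I. int_part (f i))"
  by (induction I rule: infinite_finite_induct) auto

definition act :: "'a::ab_group_add endo fps \<Rightarrow> 'a fps \<Rightarrow> 'a fps" where
  "act F x = Abs_fps (\<lambda>n. \<Sum>i=0..n. app (F $ i) (x $ (n - i)))"

lemma act_nth: "act F x $ n = (\<Sum>i=0..n. app (F $ i) (x $ (n - i)))"
  by (simp add: act_def)

lemma act_add: "act F (x + y) = act F x + act F y"
  and act_plus: "act (F + G) x = act F x + act G x"
  by (rule fps_ext; simp add: act_nth app_add app_plus sum.distrib)+

lemma act_0 [simp]: "act F 0 = 0"
  by (rule fps_ext) (simp add: act_nth)

lemma act_diff: "act F (x - y) = act F x - act F y"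
  using act_add [of F "x - y" y] by (simp add: algebra_simps)

lemma act_sum: "act F (sum g I) = (\<Sum>i\<in>I. act F (g i))"
  by (induction I rule: infinite_finite_induct) (auto simp: act_add)

lemma act_fun_sum: "act (sum F I) x = (\<Sum>i\<in>I. act (F i) x)"
  by (rule fps_ext) (simp add: act_nth fps_sum_nth app_fun_sum sum.swap [of _ I])

lemma act_one [simp]: "act 1 x = x"
  by (rule fps_ext) (simp add: act_nth fps_one_def if_distrib [of "\<lambda>f. app f _"] sum.delta cong: if_cong)

lemma act_mult: "act (F * G) x = act F (act G x)"
proof (rule fps_ext)
  fix n
  have "act (F * G) x $ n = (\<Sum>j=0..n. \<Sum>i=0..j. app (F $ i) (app (G $ (j - i)) (x $ (n - j))))"
    by (simp add: act_nth fps_mult_nth app_fun_sum app_times)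
  also have "\<dots> = (\<Sum>j=0..n. \<Sum>i=0..n-j. app (F $ j) (app (G $ i) (x $ (n - j - i))))"
    by (rule fps_mult_assoc_lemma)
  also have "\<dots> = act F (act G x) $ n"
    by (simp add: act_nth app_sum)
  finally show "act (F * G) x $ n = act F (act G x) $ n" .
qed

lemma act_cong: "(\<And>k x. app (F $ k) x = app (G $ k) x) \<Longrightarrow> act F x = act G x"
  by (rule fps_ext) (simp add: act_nth)

lemma act_commute:
  assumes "\<And>i j x. app (F $ i) (app (G $ j) x) = app (G $ j) (app (F $ i) x)"
  shows "act F (act G x) = act G (act F x)"
  unfolding act_mult [symmetric]
proof (rule act_cong)
  fix n x
  have "app ((F * G) $ n) x = (\<Sum>i=0..n. app (G $ (n - i)) (app (F $ i) x))"
    by (simp add: fps_mult_nth app_fun_sum app_times assms)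
  also have "\<dots> = (\<Sum>i=0..n. app (G $ (n - (n - i))) (app (F $ (n - i)) x))"
    using sum.nat_diff_reindex [of "\<lambda>i. app (G $ (n - i)) (app (F $ i) x)" "Suc n"]
    by (simp add: atLeast0AtMost lessThan_Suc_atMost)
  also have "\<dots> = app ((G * F) $ n) x"
    by (simp add: fps_mult_nth app_fun_sum app_times)
  finally show "app ((F * G) $ n) x = app ((G * F) $ n) x" .
qed

section \<open>Functions of lists that are additive in each entry\<close>

text \<open>
Identities between expressions that are additive in each entry of a list can be checked on generators;
this is how statements about homogeneous classes pass to arbitrary classes and to Laurent
polynomials.
\<close>

inductive_set add_span :: "'a::comm_monoid_add set \<Rightarrow> 'a set" for E where
  zero: "0 \<in> add_span E"
| add: "x \<in> E \<Longrightarrow> y \<in> add_span E \<Longrightarrow> x + y \<in> add_span E"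

lemma add_span_add: "x \<in> add_span E \<Longrightarrow> y \<in> add_span E \<Longrightarrow> x + y \<in> add_span E"
  by (induction rule: add_span.induct) (auto simp: add.assoc intro: add_span.intros)

lemma add_span_base: "x \<in> E \<Longrightarrow> x \<in> add_span E"
  using add_span.add [OF _ add_span.zero] by fastforce

lemma add_span_sum: "(\<And>i. i \<in> I \<Longrightarrow> f i \<in> add_span E) \<Longrightarrow> sum f I \<in> add_span E"
  by (induction I rule: infinite_finite_induct) (auto intro: add_span_add add_span.zero)

text \<open>
The length is fixed because products of classes are defined by duality from invariants with at
least three insertions, and so are additive only on lists of length at least 2.
\<close>

definition multi_additive :: "nat \<Rightarrow> ('a::ab_group_add list \<Rightarrow> 'b::ab_group_add) \<Rightarrow> bool" where
  "multi_additive n F \<longleftrightarrow> (\<forall>xs x y ys. Suc (length xs + length ys) = n \<longrightarrow>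
     F (xs @ (x + y) # ys) = F (xs @ x # ys) + F (xs @ y # ys))"

lemma multi_additiveD:
  "multi_additive n F \<Longrightarrow> Suc (length xs + length ys) = n \<Longrightarrow>
     F (xs @ (x + y) # ys) = F (xs @ x # ys) + F (xs @ y # ys)"
  by (simp add: multi_additive_def)

lemma multi_additive_0:
  assumes "multi_additive n F" "Suc (length xs + length ys) = n"
  shows "F (xs @ 0 # ys) = 0"
  using multi_additiveD [OF assms, of 0 0] by simp

lemma multi_additive_Cons: "multi_additive (Suc n) F \<Longrightarrow> multi_additive n (\<lambda>vs. F (v # vs))"
  unfolding multi_additive_def by (metis append_Cons length_Cons add_Suc)

lemma multi_additive_induct:
  assumes F: "multi_additive (length xs) F"
    and xs: "list_all2 (\<lambda>x E. x \<in> add_span E) xs Es"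
    and base: "\<And>ys. list_all2 (\<lambda>y E. y \<in> E) ys Es \<Longrightarrow> F ys \<in> Z"
    and Z: "0 \<in> Z" "\<And>x y. x \<in> Z \<Longrightarrow> y \<in> Z \<Longrightarrow> x + y \<in> Z"
  shows "F xs \<in> Z"
proof -
  have "F (ps @ xs) \<in> Z"
    if "list_all2 (\<lambda>x E. x \<in> add_span E) xs Es2" "list_all2 (\<lambda>y E. y \<in> E) ps Es1"
      "multi_additive (length (ps @ xs)) F" "Es = Es1 @ Es2" for ps Es1 Es2
    using that
  proof (induction xs arbitrary: ps Es1 Es2)
    case Nil
    then show ?case using base by auto
  next
    case (Cons x xs)
    obtain E Es2' where Es2: "Es2 = E # Es2'" and x: "x \<in> add_span E"
      and xs: "list_all2 (\<lambda>x E. x \<in> add_span E) xs Es2'"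
      using Cons.prems(1) by (auto simp: list_all2_Cons1)
    from x show ?case
    proof (induction rule: add_span.induct)
      case zero
      then show ?case
        using multi_additive_0 [OF Cons.prems(3), of ps xs] Z by simp
    next
      case (add x y)
      have "F ((ps @ [x]) @ xs) \<in> Z"
        by (rule Cons.IH [OF xs, of _ "Es1 @ [E]"])
          (use add Cons.prems Es2 in \<open>auto intro: list_all2_appendI\<close>)
      then show ?case
        using multi_additiveD [OF Cons.prems(3), of ps xs x y] add Z by simp
    qed
  qed
  from this [of Es "[]" "[]"] show ?thesis
    using F xs by simp
qed

lemma sum_list_nths:
  "(\<Sum>x\<leftarrow>nths xs I. f x) + (\<Sum>x\<leftarrow>nths xs (- I). f x) = (\<Sum>x\<leftarrow>xs. f x :: 'b::comm_monoid_add)"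
proof (induction xs arbitrary: I)
  case (Cons x xs)
  have "{j. Suc j \<in> - I} = - {j. Suc j \<in> I}" by auto
  then show ?case
    using Cons [of "{j. Suc j \<in> I}"] by (auto simp: nths_Cons algebra_simps)
qed simp

lemma nths_middle:
  "nths (as @ s # bs) I = nths as I @ (if length as \<in> I then [s] else []) @ nths bs {j. Suc (j + length as) \<in> I}"
  by (simp add: nths_append nths_Cons)

lemma length_nths_le: "length (nths xs I) \<le> length xs"
proof -
  have "card {i. i < length xs \<and> i \<in> I} \<le> card {..<length xs}"
    by (rule card_mono) auto
  then show ?thesis by (simp add: length_nths)
qed

lemma nths_replicate: "nths (replicate n a) I = replicate (card {i. i < n \<and> i \<in> I}) a"
  by (rule replicate_eqI) (auto simp: length_nths dest: in_set_nthsD)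

section \<open>Graded sums\<close>

lemma graded_sum_0: "(0 :: 'b::comm_monoid_add) \<in> graded_sum G"
  unfolding graded_sum_def by (intro CollectI exI [of _ "{}"]) simp

lemma graded_sum_base: "x \<in> G d \<Longrightarrow> (x :: 'b::comm_monoid_add) \<in> graded_sum G"
  unfolding graded_sum_def by (intro CollectI exI [of _ "{d}"] exI [of _ "\<lambda>_. x"]) simp

lemma graded_sum_add:
  fixes x y :: "'b::comm_monoid_add"
  assumes G: "\<And>d. 0 \<in> G d" "\<And>d u w. u \<in> G d \<Longrightarrow> w \<in> G d \<Longrightarrow> u + w \<in> G d"
    and x: "x \<in> graded_sum G" and y: "y \<in> graded_sum G"
  shows "x + y \<in> graded_sum G"
proof -
  obtain D f where f: "finite D" "\<And>d. d \<in> D \<Longrightarrow> f d \<in> G d" "x = (\<Sum>d\<in>D. f d)"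
    using x unfolding graded_sum_def by blast
  obtain D' g where g: "finite D'" "\<And>d. d \<in> D' \<Longrightarrow> g d \<in> G d" "y = (\<Sum>d\<in>D'. g d)"
    using y unfolding graded_sum_def by blast
  define h where "h d = (if d \<in> D then f d else 0) + (if d \<in> D' then g d else 0)" for d
  have "x + y = (\<Sum>d\<in>D \<union> D'. h d)"
    unfolding h_def sum.distrib f(3) g(3) using f(1) g(1)
    by (intro arg_cong2 [where f = "(+)"] sum.mono_neutral_cong_left) auto
  moreover have "h d \<in> G d" for d
    using f(2) g(2) G by (auto simp: h_def)
  ultimately show ?thesis
    unfolding graded_sum_def using f(1) g(1) by blast
qed

section \<open>Gromov-Witten invariants and Poincare duality\<close>

locale monotone_gw =
  fixes M :: "('v::ab_group_add, 'h::ab_group_add) gw_data"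
  assumes M: "closed_monotone_symplectic M"
begin

lemma cohomology: "closed_manifold_cohomology M"
  and classes: "monotone_classes M"
  and gw: "gw_axioms M"
  using M by (auto simp: closed_monotone_symplectic_def)

sublocale V: vector_space "scal M"
  using cohomology by (simp add: closed_manifold_cohomology_def)

abbreviation top_deg :: int where "top_deg \<equiv> 2 * int (half_dim M)"

lemma finite_span: "\<exists>B. finite B \<and> V.span B = UNIV"
  and coh_subspace: "V.subspace (coh M d)"
  and coh_out: "d < 0 \<or> d > top_deg \<Longrightarrow> coh M d = {0}"
  and coh_decomp: "\<exists>!c. (\<forall>d. c d \<in> coh M d) \<and> x = (\<Sum>d = 0..top_deg. c d)"
  and cup_coh: "x \<in> coh M a \<Longrightarrow> y \<in> coh M b \<Longrightarrow> cup M x y \<in> coh M (a + b)"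
  and cup_unit: "cup M (coh_unit M) x = x"
  and integ_coh: "d \<noteq> top_deg \<Longrightarrow> x \<in> coh M d \<Longrightarrow> integ M x = 0"
  and cup_nondegenerate: "(\<And>y. integ M (cup M x y) = 0) \<Longrightarrow> x = 0"
  and cup_linear_left: "Vector_Spaces.linear (scal M) (scal M) (\<lambda>x. cup M x z)"
  and cup_linear_right: "Vector_Spaces.linear (scal M) (scal M) (cup M z)"
  and integ_linear: "Vector_Spaces.linear (scal M) (*) (integ M)"
  by (use cohomology [unfolded closed_manifold_cohomology_def] in \<open>(elim conjE, (blast | metis))\<close>)+

lemma cup_add_left: "cup M (x + y) z = cup M x z + cup M y z"
  and cup_add_right: "cup M z (x + y) = cup M z x + cup M z y"
  and cup_scal_left: "cup M (scal M c x) z = scal M c (cup M x z)"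
  and cup_scal_right: "cup M z (scal M c x) = scal M c (cup M z x)"
  and integ_add: "integ M (x + y) = integ M x + integ M y"
  and integ_scal: "integ M (scal M c x) = c * integ M x"
  using cup_linear_left [of z] cup_linear_right [of z] integ_linear
  by (simp_all add: Vector_Spaces.linear_iff)

lemma gw_linear: "length xs + length ys \<ge> 2 \<Longrightarrow>
    Vector_Spaces.linear (scal M) (*) (\<lambda>x. gw M A (xs @ x # ys))"
  using gw unfolding gw_axioms_def by (elim conjE) blast

lemma gw_add: "length xs + length ys \<ge> 2 \<Longrightarrow>
    gw M A (xs @ (x + y) # ys) = gw M A (xs @ x # ys) + gw M A (xs @ y # ys)"
  and gw_scal: "length xs + length ys \<ge> 2 \<Longrightarrow>
    gw M A (xs @ scal M c x # ys) = c * gw M A (xs @ x # ys)"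
  using gw_linear [of xs ys A] by (simp_all add: Vector_Spaces.linear_iff)

lemmas gw_swap = gw [unfolded gw_axioms_def, THEN conjunct2, THEN conjunct1, rule_format]
lemmas gw_degree = gw [unfolded gw_axioms_def, THEN conjunct2, THEN conjunct2, THEN conjunct1, rule_format]
lemmas gw_energy = gw [unfolded gw_axioms_def, THEN conjunct2, THEN conjunct2, THEN conjunct2, THEN conjunct1, rule_format]
lemmas gw_compact = gw [unfolded gw_axioms_def, THEN conjunct2, THEN conjunct2, THEN conjunct2, THEN conjunct2, THEN conjunct1, rule_format]
lemmas gw_point3 = gw [unfolded gw_axioms_def, THEN conjunct2, THEN conjunct2, THEN conjunct2, THEN conjunct2, THEN conjunct2, THEN conjunct1, rule_format]
lemmas gw_unit = gw [unfolded gw_axioms_def, THEN conjunct2, THEN conjunct2, THEN conjunct2, THEN conjunct2, THEN conjunct2, THEN conjunct2, THEN conjunct2, THEN conjunct1, rule_format]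
lemmas gw_divisor = gw [unfolded gw_axioms_def, THEN conjunct2, THEN conjunct2, THEN conjunct2, THEN conjunct2, THEN conjunct2, THEN conjunct2, THEN conjunct2, THEN conjunct2, THEN conjunct1, rule_format]
lemmas gw_splitting = gw [unfolded gw_axioms_def, THEN conjunct2, THEN conjunct2, THEN conjunct2, THEN conjunct2, THEN conjunct2, THEN conjunct2, THEN conjunct2, THEN conjunct2, THEN conjunct2, rule_format]

lemma chern_coh: "chern M \<in> coh M 2"
  and chern_pairing: "pairing M (chern M) A = of_int (chern_num M A)"
  and area_add: "area M (A + B) = area M A + area M B"
  and monotone: "\<exists>r>0. \<forall>A. of_int (chern_num M A) = r * area M A"
  by (use classes [unfolded monotone_classes_def] in \<open>elim conjE, blast\<close>)+

lemma coh_0: "0 \<in> coh M d"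
  and coh_add: "x \<in> coh M d \<Longrightarrow> y \<in> coh M d \<Longrightarrow> x + y \<in> coh M d"
  and coh_scal: "x \<in> coh M d \<Longrightarrow> scal M c x \<in> coh M d"
  using coh_subspace by (auto simp: V.subspace_def)

lemma coh_sum: "(\<And>i. i \<in> I \<Longrightarrow> f i \<in> coh M d) \<Longrightarrow> sum f I \<in> coh M d"
  using coh_subspace V.subspace_sum by blast

lemma cup_0_left [simp]: "cup M 0 z = 0" and cup_0_right [simp]: "cup M z 0 = 0"
  and integ_0 [simp]: "integ M 0 = 0"
  using cup_scal_left [of 0 0 z] cup_scal_right [of z 0 0] integ_scal [of 0 0] by simp_all

lemma cup_sum_left: "cup M (sum f I) z = (\<Sum>i\<in>I. cup M (f i) z)"
  by (induction I rule: infinite_finite_induct) (auto simp: cup_add_left)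

lemma integ_sum: "integ M (sum f I) = (\<Sum>i\<in>I. integ M (f i))"
  by (induction I rule: infinite_finite_induct) (auto simp: integ_add)

definition homog :: "'v set" where "homog = (\<Union>d\<in>{0..top_deg}. coh M d)"

lemma add_span_homog: "x \<in> add_span homog"
proof -
  obtain c where "\<And>d. c d \<in> coh M d" "x = (\<Sum>d = 0..top_deg. c d)"
    using coh_decomp by blast
  then show ?thesis
    by (metis UN_I add_span_base add_span_sum homog_def)
qed

lemma integ_cup_eqI:
  assumes "\<And>z. integ M (cup M u z) = integ M (cup M w z)"
  shows "u = w"
proof -
  have "integ M (cup M (u + scal M (-1) w) y) = 0" for y
    by (simp only: cup_add_left cup_scal_left integ_add integ_scal) (simp add: assms)
  then have "u + scal M (-1) w = 0"
    by (rule cup_nondegenerate)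
  then show ?thesis
    by (simp add: V.scale_minus_left)
qed

text \<open>
Nondegeneracy is only assumed as injectivity of the map from a class to its functional. In finite
dimension this gives surjectivity: composed with the identification of functionals with vectors by a basis,
the map is an injective linear endomorphism.
\<close>

lemma functional_represented:
  assumes add: "\<And>x y. \<phi> (x + y) = \<phi> x + \<phi> y" and scal: "\<And>c x. \<phi> (scal M c x) = c * \<phi> x"
  obtains w where "\<And>z. integ M (cup M w z) = \<phi> z"
proof -
  obtain B0 where B0: "finite B0" "V.span B0 = UNIV"
    using finite_span by blast
  obtain B where B: "B \<subseteq> B0" "V.independent B" "B0 \<subseteq> V.span B"
    using V.maximal_independent_subset [of B0] by blast
  have span_B: "V.span B = UNIV"
    using V.span_minimal [OF B(3) V.subspace_span] B0 by auto
  have fin: "finite B"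
    using B B0 finite_subset by blast
  interpret finite_dimensional_vector_space "scal M" B
    by unfold_locales (use fin B(2) span_B in auto)
  define f where "f x = (\<Sum>v\<in>B. scal M (integ M (cup M x v)) v)" for x
  have lin: "Vector_Spaces.linear (scal M) (scal M) f"
    unfolding Vector_Spaces.linear_iff
    using V.vector_space_axioms
    by (auto simp: f_def cup_add_left cup_scal_left integ_add integ_scal
        V.scale_left_distrib sum.distrib V.scale_sum_right)
  have coeff_eq: "g v = h v" if "(\<Sum>v\<in>B. scal M (g v) v) = (\<Sum>v\<in>B. scal M (h v) v)" "v \<in> B" for g h v
  proof -
    have "(\<Sum>v\<in>B. scal M (g v - h v) v) = 0"
      using that by (simp add: V.scale_left_diff_distrib sum_subtractf)
    then have "g v - h v = 0"
      using V.independentD [OF B(2) fin subset_refl, of "\<lambda>v. g v - h v"] that by blast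
    then show ?thesis by simp
  qed
  have ext: "(\<And>v. v \<in> B \<Longrightarrow> integ M (cup M w v) = \<psi> v) \<Longrightarrow> integ M (cup M w z) = \<psi> z"
    if "\<And>x y. \<psi> (x + y) = \<psi> x + \<psi> y" "\<And>c x. \<psi> (scal M c x) = c * \<psi> x" for w \<psi> z
  proof -
    assume *: "\<And>v. v \<in> B \<Longrightarrow> integ M (cup M w v) = \<psi> v"
    have "V.subspace {z. integ M (cup M w z) = \<psi> z}"
      using that that(2) [of 0 0]
      by (auto simp: V.subspace_def cup_add_right cup_scal_right integ_add integ_scal)
    then have "V.span B \<subseteq> {z. integ M (cup M w z) = \<psi> z}"
      using * by (intro V.span_minimal) auto
    then show ?thesis
      using span_B by auto
  qed
  have "inj f"
  proof (rule injI)
    fix x y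
    assume "f x = f y"
    then have "integ M (cup M x v) = integ M (cup M y v)" if "v \<in> B" for v
      using coeff_eq [of "\<lambda>v. integ M (cup M x v)" "\<lambda>v. integ M (cup M y v)"] that
      unfolding f_def by blast
    then have "integ M (cup M x z) = integ M (cup M y z)" for z
      using ext [of "\<lambda>z. integ M (cup M y z)" x z]
      by (simp add: cup_add_right cup_scal_right integ_add integ_scal)
    then show "x = y"
      by (rule integ_cup_eqI)
  qed
  then have "surj f"
    using linear_inj_imp_surj lin by blast
  then obtain w where "f w = (\<Sum>v\<in>B. scal M (\<phi> v) v)"
    by (metis surjD)
  then have "integ M (cup M w v) = \<phi> v" if "v \<in> B" for v
    using coeff_eq [of "\<lambda>v. integ M (cup M w v)" \<phi>] that unfolding f_def by blast
  then have "integ M (cup M w z) = \<phi> z" for z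
    using ext [of \<phi> w z] add scal by blast
  then show thesis
    using that by blast
qed

lemma integ_gw_dual:
  assumes "length xs \<ge> 2"
  shows "integ M (cup M (gw_dual M A xs) z) = gw M A (xs @ [z])"
proof -
  obtain w where w: "\<And>z. integ M (cup M w z) = gw M A (xs @ [z])"
    using functional_represented [of "\<lambda>z. gw M A (xs @ [z])"] gw_add [of xs "[]"] gw_scal [of xs "[]"] assms
    by force
  have "gw_dual M A xs = w"
    unfolding gw_dual_def
  proof (rule the_equality)
    fix w'
    assume "\<forall>z. integ M (cup M w' z) = gw M A (xs @ [z])"
    then show "w' = w"
      using w by (intro integ_cup_eqI) simp
  qed (use w in simp)
  then show ?thesis
    using w by simp
qed

lemma gw_dual_eqI:
  assumes "length xs \<ge> 2" "\<And>z. integ M (cup M w z) = gw M A (xs @ [z])"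
  shows "gw_dual M A xs = w"
  using assms integ_gw_dual by (auto intro: integ_cup_eqI)

lemma multi_additive_gw_dual:
  assumes "n \<ge> 2"
  shows "multi_additive n (gw_dual M A)"
  unfolding multi_additive_def
proof (intro allI impI)
  fix xs ys :: "'v list" and x y
  assume n: "Suc (length xs + length ys) = n"
  have "gw M A (xs @ (x + y) # (ys @ [z])) = gw M A (xs @ x # (ys @ [z])) + gw M A (xs @ y # (ys @ [z]))" for z
    by (rule gw_add) (use n assms in auto)
  then show "gw_dual M A (xs @ (x + y) # ys) = gw_dual M A (xs @ x # ys) + gw_dual M A (xs @ y # ys)"
    using n assms by (intro gw_dual_eqI) (auto simp: cup_add_left integ_add integ_gw_dual)
qed

lemma gw_dual_scal:
  assumes "length xs + length ys \<ge> 1"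
  shows "gw_dual M A (xs @ scal M c x # ys) = scal M c (gw_dual M A (xs @ x # ys))"
proof (rule gw_dual_eqI)
  fix z
  have "gw M A (xs @ scal M c x # (ys @ [z])) = c * gw M A (xs @ x # (ys @ [z]))"
    by (rule gw_scal) (use assms in auto)
  then show "integ M (cup M (scal M c (gw_dual M A (xs @ x # ys))) z) = gw M A ((xs @ scal M c x # ys) @ [z])"
    using assms by (auto simp: cup_scal_left integ_scal integ_gw_dual)
qed (use assms in auto)

lemma gw_dual_swap:
  assumes "x \<in> coh M a" "even a"
  shows "gw_dual M A (xs @ y # x # ys) = gw_dual M A (xs @ x # y # ys)"
proof (rule gw_dual_eqI)
  fix z
  define G where "G y = gw M A (xs @ y # x # ys @ [z]) - gw M A ((xs @ [x]) @ y # ys @ [z])" for y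
  have G_add: "G (u + v) = G u + G v" for u v
    unfolding G_def by (subst gw_add, simp, subst gw_add, simp, simp)
  have G_homog: "G v = 0" if "v \<in> homog" for v
    using that assms gw_swap [OF assms(1), of v _ xs "ys @ [z]" A] by (auto simp: G_def homog_def)
  have "y \<in> add_span homog"
    by (rule add_span_homog)
  then have "G y = 0"
  proof (induction rule: add_span.induct)
    case zero
    then show ?case using G_add [of 0 0] by simp
  next
    case (add x y)
    then show ?case by (simp add: G_add G_homog)
  qed
  then show "integ M (cup M (gw_dual M A (xs @ x # y # ys)) z) = gw M A ((xs @ y # x # ys) @ [z])"
    by (simp add: G_def integ_gw_dual)
qed simp

text \<open>
By duality the degree of a class can be detected by integrating it against homogeneous classes.
\<close>

lemma cohI:
  assumes w: "\<And>b z. z \<in> coh M b \<Longrightarrow> a + b \<noteq> top_deg \<Longrightarrow> integ M (cup M w z) = 0"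
  shows "w \<in> coh M a"
proof -
  obtain c where c: "\<And>d. c d \<in> coh M d" "w = (\<Sum>d = 0..top_deg. c d)"
    using coh_decomp by blast
  \<comment> \<open>The component in degree \<open>d\<close> only sees classes of degree \<open>top_deg - d\<close>, and there \<open>w\<close> integrates to 0.\<close>
  have c0: "c d = 0" if d: "d \<in> {0..top_deg}" "d \<noteq> a" for d
  proof (rule cup_nondegenerate)
    fix y
    have hom: "integ M (cup M (c d) z) = 0" if z: "z \<in> homog" for z
    proof -
      obtain b where b: "z \<in> coh M b" using z by (auto simp: homog_def)
      show ?thesis
      proof (cases "d + b = top_deg")
        case False
        then show ?thesis
          using integ_coh cup_coh [OF c(1) b] by blast
      next
        case True
        have "integ M (cup M (c d') z) = 0" if "d' \<noteq> d" for d'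
          using that True integ_coh [OF _ cup_coh [OF c(1) b, of d']] by simp
        then have "integ M (cup M w z) = (\<Sum>d' = 0..top_deg. if d' = d then integ M (cup M (c d) z) else 0)"
          unfolding c(2) cup_sum_left integ_sum by (intro sum.cong) auto
        also have "\<dots> = integ M (cup M (c d) z)"
          using d by (simp add: sum.delta)
        finally show ?thesis
          using w [OF b] True d by auto
      qed
    qed
    have "y \<in> add_span homog"
      by (rule add_span_homog)
    then show "integ M (cup M (c d) y) = 0"
      by (induction rule: add_span.induct) (auto simp: cup_add_right integ_add hom)
  qed
  have "(\<Sum>d = 0..top_deg. c d) \<in> coh M a"
    by (rule coh_sum) (metis c(1) c0 coh_0)
  then show ?thesis
    using c(2) by simp
qed

lemma gw_dual_coh:
  assumes "list_all2 (\<lambda>x d. x \<in> coh M d) xs ds" "length xs \<ge> 2"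
  shows "gw_dual M A xs \<in> coh M (sum_list ds - 2 * chern_num M A - 2 * (int (length xs) - 2))"
proof (rule cohI)
  fix b z
  assume z: "z \<in> coh M b"
    and ne: "sum_list ds - 2 * chern_num M A - 2 * (int (length xs) - 2) + b \<noteq> top_deg"
  show "integ M (cup M (gw_dual M A xs) z) = 0"
  proof (rule ccontr)
    assume "\<not> ?thesis"
    then have "gw M A (xs @ [z]) \<noteq> 0"
      using assms by (simp add: integ_gw_dual)
    moreover have "list_all2 (\<lambda>x d. x \<in> coh M d) (xs @ [z]) (ds @ [b])"
      using assms z by (auto intro: list_all2_appendI)
    ultimately show False
      using gw_degree [of "xs @ [z]" "ds @ [b]" A] assms ne by simp
  qed
qed

text \<open>
Monotonicity bounds the degree of contributing classes: a product of \<open>k\<close> classes has nonnegative degree,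
at most \<open>2nk\<close> minus twice the Chern number, where \<open>2n\<close> is the dimension. So these sets are finite, and they contain every
class that contributes to a product of \<open>k\<close> factors.
\<close>

definition gw_classes :: "nat \<Rightarrow> 'h set" where
  "gw_classes k = {A. gw_class M A \<and> chern_num M A \<le> int (half_dim M) * int k}"

lemma finite_gw_classes [simp]: "finite (gw_classes k)"
proof -
  obtain r where r: "r > 0" "\<And>A. of_int (chern_num M A) = r * area M A"
    using monotone by blast
  have "area M A \<le> of_int (int (half_dim M) * int k) / r" if "A \<in> gw_classes k" for A
  proof -
    have "r * area M A \<le> of_int (int (half_dim M) * int k)"
      using that unfolding gw_classes_def r(2) [symmetric] of_int_le_iff by simp
    then show ?thesis
      using r(1) by (simp add: pos_le_divide_eq mult.commute)
  qed
  then have "gw_classes k \<subseteq> {A. gw_class M A \<and> area M A \<le> of_int (int (half_dim M) * int k) / r}"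
    by (auto simp: gw_classes_def)
  then show ?thesis
    using gw_compact finite_subset by blast
qed

lemma gw_dual_eq_0:
  assumes "length xs \<ge> 2" "A \<notin> gw_classes (length xs)"
  shows "gw_dual M A xs = 0"
proof (cases "gw_class M A")
  case False
  then show ?thesis
    using assms by (intro gw_dual_eqI) (auto simp: gw_class_def)
next
  case True
  then have c: "chern_num M A > int (half_dim M) * int (length xs)"
    using assms by (auto simp: gw_classes_def)
  have base: "gw_dual M A ys = 0" if ys: "list_all2 (\<lambda>y E. y \<in> E) ys (replicate (length xs) homog)" for ys
  proof -
    have len: "length ys = length xs"
      using list_all2_lengthD [OF ys] by simp
    have "\<exists>ds. list_all2 (\<lambda>x d. x \<in> coh M d) ys ds \<and> sum_list ds \<le> top_deg * int (length ys)"
      using ys len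
    proof (induction ys arbitrary: xs)
      case (Cons y ys)
      then obtain n where n: "length xs = Suc n" by (cases "length xs") auto
      with Cons.prems have y: "y \<in> homog" and ys: "list_all2 (\<lambda>y E. y \<in> E) ys (replicate (length (tl xs)) homog)"
        by auto
      obtain ds where "list_all2 (\<lambda>x d. x \<in> coh M d) ys ds" "sum_list ds \<le> top_deg * int (length ys)"
        using Cons.IH [OF ys] Cons.prems n by auto
      moreover obtain d where "y \<in> coh M d" "d \<le> top_deg"
        using y by (auto simp: homog_def)
      ultimately show ?case
        by (intro exI [of _ "d # ds"]) (auto simp: algebra_simps)
    qed auto
    then obtain ds where ds: "list_all2 (\<lambda>x d. x \<in> coh M d) ys ds" "sum_list ds \<le> top_deg * int (length ys)"
      by blast
    have "sum_list ds - 2 * chern_num M A - 2 * (int (length ys) - 2) < 0"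
      using ds(2) c assms len by simp
    then show ?thesis
      using gw_dual_coh [OF ds(1), of A] coh_out len assms by (metis singletonD)
  qed
  have span: "list_all2 (\<lambda>x E. x \<in> add_span E) xs (replicate (length xs) homog)"
    by (auto simp: list_all2_conv_all_nth add_span_homog)
  have "gw_dual M A xs \<in> {0}"
    by (rule multi_additive_induct [OF multi_additive_gw_dual [OF assms(1)] span]) (auto simp: base)
  then show ?thesis by simp
qed

lemma gw_dual_divisor:
  assumes "length xs \<ge> 2"
  shows "gw_dual M A (chern M # xs) = scal M (of_int (chern_num M A)) (gw_dual M A xs)"
proof (rule gw_dual_eqI)
  fix z
  have "gw M A (chern M # xs @ [z]) = of_int (chern_num M A) * gw M A (xs @ [z])"
    using gw_divisor [OF chern_coh, of "xs @ [z]" A] assms by (simp add: chern_pairing)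
  then show "integ M (cup M (scal M (of_int (chern_num M A)) (gw_dual M A xs)) z) = gw M A ((chern M # xs) @ [z])"
    using assms by (simp add: cup_scal_left integ_scal integ_gw_dual)
qed (use assms in simp)

lemma gw_dual_unit: "gw_dual M A [coh_unit M, x] = (if A = 0 then x else 0)"
  by (intro gw_dual_eqI) (auto simp: gw_point3 gw_unit cup_unit)

section \<open>Extension to Laurent polynomials\<close>

text \<open>
Multiplication by the monomial $c q^i$.
\<close>

definition mon :: "Qbar \<Rightarrow> int \<Rightarrow> 'v laurent \<Rightarrow> 'v laurent" where
  "mon c i x = (\<Sum>j\<in>Poly_Mapping.keys x. Poly_Mapping.single (i + j) (scal M c (Poly_Mapping.lookup x j)))"

lemma laurent_scale_mon:
  "laurent_scale M a x = (\<Sum>i\<in>Poly_Mapping.keys a. mon (Poly_Mapping.lookup a i) i x)"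
  by (simp add: laurent_scale_def mon_def)

lemma lookup_mon: "Poly_Mapping.lookup (mon c i x) n = scal M c (Poly_Mapping.lookup x (n - i))"
proof -
  have "Poly_Mapping.lookup (mon c i x) n =
      (\<Sum>j\<in>Poly_Mapping.keys x. if j = n - i then scal M c (Poly_Mapping.lookup x j) else 0)"
    unfolding mon_def lookup_sum by (intro sum.cong) (auto simp: lookup_single when_def)
  also have "\<dots> = scal M c (Poly_Mapping.lookup x (n - i))"
    by (simp add: sum.delta in_keys_iff)
  finally show ?thesis .
qed

lemma lookup_q_deriv: "Poly_Mapping.lookup (q_deriv M x) n = scal M (of_int n) (Poly_Mapping.lookup x n)"
proof -
  have "Poly_Mapping.lookup (q_deriv M x) n =
      (\<Sum>j\<in>Poly_Mapping.keys x. if j = n then scal M (of_int j) (Poly_Mapping.lookup x j) else 0)"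
    unfolding q_deriv_def lookup_sum by (intro sum.cong) (auto simp: lookup_single when_def)
  also have "\<dots> = scal M (of_int n) (Poly_Mapping.lookup x n)"
    by (simp add: sum.delta in_keys_iff)
  finally show ?thesis .
qed

lemma mon_add: "mon c i (x + y) = mon c i x + mon c i y"
  and mon_add_left: "mon (c + d) i x = mon c i x + mon d i x"
  and mon_mon: "mon c i (mon d j x) = mon (c * d) (i + j) x"
  and mon_1 [simp]: "mon 1 0 x = x"
  and mon_0 [simp]: "mon c i 0 = 0"
  and mon_zero [simp]: "mon 0 i x = 0"
  and mon_single: "mon c i (Poly_Mapping.single j v) = Poly_Mapping.single (i + j) (scal M c v)"
  by (rule poly_mapping_eqI; simp add: lookup_mon lookup_add lookup_single when_def
      V.scale_right_distrib V.scale_left_distrib algebra_simps)+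

lemma mon_commute: "mon c i (mon d j x) = mon d j (mon c i x)"
  by (simp add: mon_mon algebra_simps)

lemma mon_sum: "mon c i (sum f I) = (\<Sum>k\<in>I. mon c i (f k))"
  by (induction I rule: infinite_finite_induct) (auto simp: mon_add)

lemma q_deriv_add: "q_deriv M (x + y) = q_deriv M x + q_deriv M y"
  and q_deriv_0 [simp]: "q_deriv M 0 = 0"
  and q_deriv_single: "q_deriv M (Poly_Mapping.single j v) = Poly_Mapping.single j (scal M (of_int j) v)"
  by (rule poly_mapping_eqI; simp add: lookup_q_deriv lookup_add lookup_single when_def V.scale_right_distrib)+

lemma q_deriv_mon: "q_deriv M (mon c i x) = mon c i (q_deriv M x) + mon (of_int i * c) i x"
proof (rule poly_mapping_eqI)
  fix n
  have "of_int n * c = c * of_int (n - i) + of_int i * c"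
    by (simp add: algebra_simps)
  then show "Poly_Mapping.lookup (q_deriv M (mon c i x)) n
      = Poly_Mapping.lookup (mon c i (q_deriv M x) + mon (of_int i * c) i x) n"
    by (simp only: lookup_add lookup_mon lookup_q_deriv V.scale_scale V.scale_left_distrib [symmetric])
qed

lemma q_deriv_sum: "q_deriv M (sum f I) = (\<Sum>k\<in>I. q_deriv M (f k))"
  by (induction I rule: infinite_finite_induct) (auto simp: q_deriv_add)

lemma sum_singles: "(\<Sum>j\<in>Poly_Mapping.keys x. Poly_Mapping.single j (Poly_Mapping.lookup x j)) = x"
  for x :: "'v laurent"
proof (rule poly_mapping_eqI)
  fix n
  have "Poly_Mapping.lookup (\<Sum>j\<in>Poly_Mapping.keys x. Poly_Mapping.single j (Poly_Mapping.lookup x j)) n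
      = (\<Sum>j\<in>Poly_Mapping.keys x. if j = n then Poly_Mapping.lookup x j else 0)"
    unfolding lookup_sum by (intro sum.cong) (auto simp: lookup_single when_def)
  then show "Poly_Mapping.lookup (\<Sum>j\<in>Poly_Mapping.keys x. Poly_Mapping.single j (Poly_Mapping.lookup x j)) n
      = Poly_Mapping.lookup x n"
    by (simp add: sum.delta in_keys_iff)
qed

lemma laurent_deg_0: "0 \<in> laurent_deg M d"
  and laurent_deg_add: "x \<in> laurent_deg M d \<Longrightarrow> y \<in> laurent_deg M d \<Longrightarrow> x + y \<in> laurent_deg M d"
  and laurent_deg_q_deriv: "x \<in> laurent_deg M d \<Longrightarrow> q_deriv M x \<in> laurent_deg M d"
  by (auto simp: laurent_deg_def lookup_add lookup_q_deriv coh_0 coh_add coh_scal)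

lemma laurent_deg_sum: "(\<And>i. i \<in> I \<Longrightarrow> f i \<in> laurent_deg M d) \<Longrightarrow> sum f I \<in> laurent_deg M d"
  by (induction I rule: infinite_finite_induct) (auto simp: laurent_deg_0 laurent_deg_add)

lemma laurent_deg_mon:
  assumes "x \<in> laurent_deg M d"
  shows "mon c i x \<in> laurent_deg M (d + 2 * i)"
proof -
  have "Poly_Mapping.lookup x (j - i) \<in> coh M (d - 2 * (j - i))" for j
    using assms unfolding laurent_deg_def by blast
  moreover have "d - 2 * (j - i) = d + 2 * i - 2 * j" for j
    by simp
  ultimately show ?thesis
    unfolding laurent_deg_def mem_Collect_eq lookup_mon by (metis coh_scal)
qed

lemma laurent_deg_single: "v \<in> coh M (d - 2 * j) \<Longrightarrow> Poly_Mapping.single j v \<in> laurent_deg M d"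
  by (auto simp: laurent_deg_def lookup_single when_def coh_0)

definition monomials :: "int \<Rightarrow> 'v laurent set" where
  "monomials d = {Poly_Mapping.single j v | j v. v \<in> coh M (d - 2 * j)}"

lemma monomials_subset: "monomials d \<subseteq> laurent_deg M d"
  by (auto simp: monomials_def intro: laurent_deg_single)

lemma laurent_deg_add_span:
  assumes "x \<in> laurent_deg M d"
  shows "x \<in> add_span (monomials d)"
proof -
  have "Poly_Mapping.single j (Poly_Mapping.lookup x j) \<in> monomials d" for j
    using assms unfolding monomials_def laurent_deg_def by blast
  then show ?thesis
    by (metis add_span_base add_span_sum sum_singles)
qed

lemma add_span_monomials: "x \<in> add_span (\<Union>d. monomials d)"
proof -
  have "Poly_Mapping.single j v \<in> add_span (\<Union>d. monomials d)" for j v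
    using add_span_homog [of v]
  proof (induction rule: add_span.induct)
    case (add v w)
    then obtain d where "v \<in> coh M d" by (auto simp: homog_def)
    then have "Poly_Mapping.single j v \<in> monomials (d + 2 * j)"
      unfolding monomials_def by (intro CollectI exI [of _ j] exI [of _ v]) simp
    then show ?case
      using add by (auto simp: single_add intro: add_span.add)
  qed (simp add: add_span.zero)
  then show ?thesis
    by (metis add_span_sum sum_singles)
qed

text \<open>
The extension to lists of Laurent polynomials of a function on lists of classes, multilinear over
Laurent polynomials in $q$.
\<close>

primrec lext :: "'v laurent list \<Rightarrow> ('v list \<Rightarrow> 'v laurent) \<Rightarrow> 'v laurent" where
  "lext [] F = F []"
| "lext (x # xs) F = (\<Sum>j\<in>Poly_Mapping.keys x. mon 1 j (lext xs (\<lambda>vs. F (Poly_Mapping.lookup x j # vs))))"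

lemma lext_cong:
  "(\<And>vs. length vs = length xs \<Longrightarrow> F vs = G vs) \<Longrightarrow> lext xs F = lext xs G"
proof (induction xs arbitrary: F G)
  case (Cons x xs)
  show ?case
    by (auto intro!: sum.cong arg_cong [where f = "mon 1 _"] Cons.IH Cons.prems)
qed simp

lemma lext_add: "lext xs (\<lambda>vs. F vs + G vs) = lext xs F + lext xs G"
  by (induction xs arbitrary: F G) (auto simp: mon_add sum.distrib)

lemma lext_mon_fun: "lext xs (\<lambda>vs. mon c i (F vs)) = mon c i (lext xs F)"
  by (induction xs arbitrary: F) (auto simp: mon_sum intro!: sum.cong mon_commute)

lemma lext_zero: "(\<And>vs. length vs = length xs \<Longrightarrow> F vs = 0) \<Longrightarrow> lext xs F = 0"
  using lext_cong [of xs F "\<lambda>vs. mon 0 0 (F vs)"] lext_mon_fun [of xs 0 0 F] by simp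

lemma multi_additive_lext:
  assumes "multi_additive n F"
  shows "multi_additive n (\<lambda>xs. lext xs F)"
  unfolding multi_additive_def
proof (intro allI impI)
  fix xs ys :: "'v laurent list" and x y
  assume "Suc (length xs + length ys) = n"
  then show "lext (xs @ (x + y) # ys) F = lext (xs @ x # ys) F + lext (xs @ y # ys) F"
    using assms
  proof (induction xs arbitrary: F n)
    case Nil
    define f where "f j v = mon 1 j (lext ys (\<lambda>vs. F (v # vs)))" for j v
    have add: "f j (v + w) = f j v + f j w" for j v w
    proof -
      have "lext ys (\<lambda>vs. F ((v + w) # vs)) = lext ys (\<lambda>vs. F (v # vs) + F (w # vs))"
        using multi_additiveD [OF Nil(2), of "[]"] Nil(1) by (intro lext_cong) auto
      then show ?thesis by (simp add: f_def lext_add mon_add)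
    qed
    have "f j 0 = 0" for j
      using add [of j 0 0] by simp
    then show ?case
      using setsum_keys_plus_distrib [of f x y] add by (simp add: f_def)
  next
    case (Cons a xs)
    have *: "lext (xs @ (x + y) # ys) (\<lambda>vs. F (v # vs)) =
        lext (xs @ x # ys) (\<lambda>vs. F (v # vs)) + lext (xs @ y # ys) (\<lambda>vs. F (v # vs))" for v
      by (rule Cons.IH [OF refl]) (use Cons.prems in \<open>auto intro: multi_additive_Cons\<close>)
    show ?case
      by (simp add: * mon_add sum.distrib)
  qed
qed

lemma lext_single:
  assumes "multi_additive (length ps) F"
  shows "lext (map (\<lambda>p. Poly_Mapping.single (fst p) (snd p)) ps) F
    = mon 1 (\<Sum>p\<leftarrow>ps. fst p) (F (map snd ps))"
  using assms
proof (induction ps arbitrary: F)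
  case (Cons p ps)
  have F: "multi_additive (length ps) (\<lambda>vs. F (snd p # vs))"
    using Cons.prems by (simp add: multi_additive_Cons)
  have IH: "lext (map (\<lambda>p. Poly_Mapping.single (fst p) (snd p)) ps) (\<lambda>vs. F (snd p # vs))
    = mon 1 (\<Sum>p\<leftarrow>ps. fst p) (F (snd p # map snd ps))"
    by (rule Cons.IH [OF F])
  show ?case
  proof (cases "snd p = 0")
    case True
    have "F ([] @ 0 # map snd ps) = 0"
      by (rule multi_additive_0 [OF Cons.prems]) simp
    then show ?thesis
      using True by simp
  next
    case False
    then show ?thesis
      by (simp add: IH mon_mon)
  qed
qed simp

lemma lext_mon:
  assumes F: "multi_additive (Suc (length xs + length ys)) F"
    and hom: "\<And>as v bs. length as = length xs \<Longrightarrow> length bs = length ys \<Longrightarrow>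
      F (as @ scal M c v # bs) = mon c 0 (F (as @ v # bs))"
  shows "lext (xs @ mon c i x # ys) F = mon c i (lext (xs @ x # ys) F)"
  using assms
proof (induction xs arbitrary: F)
  case Nil
  define g where "g j v = mon 1 j (lext ys (\<lambda>vs. F (v # vs)))" for j v
  have g0: "g j 0 = 0" for j
    using multi_additive_0 [OF Nil(1), of "[]"] by (auto simp: g_def lext_zero)
  have "lext ys (\<lambda>vs. F (scal M c v # vs)) = mon c 0 (lext ys (\<lambda>vs. F (v # vs)))" for v
    using Nil(2) [of "[]"] by (subst lext_mon_fun [symmetric]) (auto intro: lext_cong)
  then have g_scal: "g (i + j) (scal M c v) = mon c i (g j v)" for j v
    by (simp add: g_def mon_mon)
  have keys: "Poly_Mapping.keys (mon c i x) \<subseteq> (+) i ` Poly_Mapping.keys x"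
  proof
    fix n
    assume "n \<in> Poly_Mapping.keys (mon c i x)"
    then have "n - i \<in> Poly_Mapping.keys x"
      by (auto simp: in_keys_iff lookup_mon)
    then show "n \<in> (+) i ` Poly_Mapping.keys x"
      by force
  qed
  have "(\<Sum>j\<in>Poly_Mapping.keys (mon c i x). g j (Poly_Mapping.lookup (mon c i x) j))
      = (\<Sum>j\<in>(+) i ` Poly_Mapping.keys x. g j (Poly_Mapping.lookup (mon c i x) j))"
    by (rule sum.mono_neutral_left) (use keys in \<open>auto simp: in_keys_iff g0\<close>)
  also have "\<dots> = (\<Sum>j\<in>Poly_Mapping.keys x. mon c i (g j (Poly_Mapping.lookup x j)))"
    by (subst sum.reindex) (auto simp: lookup_mon g_scal)
  finally show ?case
    by (simp add: g_def mon_sum)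
next
  case (Cons a xs)
  have *: "lext (xs @ mon c i x # ys) (\<lambda>vs. F (v # vs)) = mon c i (lext (xs @ x # ys) (\<lambda>vs. F (v # vs)))" for v
  proof (rule Cons.IH)
    show "multi_additive (Suc (length xs + length ys)) (\<lambda>vs. F (v # vs))"
      using Cons.prems(1) by (simp add: multi_additive_Cons)
    show "F (v # as @ scal M c w # bs) = mon c 0 (F (v # as @ w # bs))"
      if "length as = length xs" "length bs = length ys" for as w bs
      using Cons.prems(2) [of "v # as" bs w] that by simp
  qed
  show ?case
    by (auto simp: * mon_sum intro!: sum.cong mon_commute)
qed

lemma lext_swap:
  assumes "\<And>as i u bs. length as = length xs \<Longrightarrow> length bs = length ys \<Longrightarrow>
      F (as @ u # Poly_Mapping.lookup x i # bs) = F (as @ Poly_Mapping.lookup x i # u # bs)"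
  shows "lext (xs @ y # x # ys) F = lext (xs @ x # y # ys) F"
  using assms
proof (induction xs arbitrary: F)
  case Nil
  have "lext ys (\<lambda>vs. F (u # Poly_Mapping.lookup x i # vs)) = lext ys (\<lambda>vs. F (Poly_Mapping.lookup x i # u # vs))" for u i
    using Nil [of "[]"] by (intro lext_cong) auto
  then have "lext (y # x # ys) F = (\<Sum>j\<in>Poly_Mapping.keys y. \<Sum>i\<in>Poly_Mapping.keys x.
      mon 1 i (mon 1 j (lext ys (\<lambda>vs. F (Poly_Mapping.lookup x i # Poly_Mapping.lookup y j # vs)))))"
    by (simp add: mon_sum mon_commute)
  also have "\<dots> = lext (x # y # ys) F"
    by (subst sum.swap) (simp add: mon_sum)
  finally show ?case by simp
next
  case (Cons a xs)
  have "lext (xs @ y # x # ys) (\<lambda>vs. F (v # vs)) = lext (xs @ x # y # ys) (\<lambda>vs. F (v # vs))" for v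
    by (rule Cons.IH) (use Cons.prems [of "v # _"] in auto)
  then show ?case by simp
qed

text \<open>
The Leibniz rule: $q\partial_q$ acts on the values of \<open>F\<close> and on each argument in turn.
\<close>

lemma q_deriv_lext:
  assumes "multi_additive (length xs) F"
    and "\<And>as v bs c. Suc (length as + length bs) = length xs \<Longrightarrow>
      F (as @ scal M c v # bs) = mon c 0 (F (as @ v # bs))"
  shows "q_deriv M (lext xs F) = lext xs (\<lambda>vs. q_deriv M (F vs))
    + (\<Sum>i<length xs. lext (xs[i := q_deriv M (xs ! i)]) F)"
  using assms
proof (induction xs arbitrary: F)
  case Nil
  then show ?case by simp
next
  case (Cons x xs)
  define g where "g v = lext xs (\<lambda>vs. F (v # vs))" for v
  have g0: "g 0 = 0"
    using multi_additive_0 [OF Cons.prems(1), of "[]"] by (auto simp: g_def lext_zero)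
  have g_scal: "g (scal M c v) = mon c 0 (g v)" for c v
    unfolding g_def using Cons.prems(2) [of "[]"]
    by (subst lext_mon_fun [symmetric]) (auto intro: lext_cong)
  have IH: "q_deriv M (g v) = lext xs (\<lambda>vs. q_deriv M (F (v # vs)))
      + (\<Sum>i<length xs. lext (xs[i := q_deriv M (xs ! i)]) (\<lambda>vs. F (v # vs)))" for v
    unfolding g_def
  proof (rule Cons.IH)
    show "multi_additive (length xs) (\<lambda>vs. F (v # vs))"
      using Cons.prems(1) by (simp add: multi_additive_Cons)
    show "F (v # as @ scal M c w # bs) = mon c 0 (F (v # as @ w # bs))"
      if "Suc (length as + length bs) = length xs" for as w bs c
      using Cons.prems(2) [of "v # as" bs c w] that by simp
  qed
  have "lext (q_deriv M x # xs) F = (\<Sum>j\<in>Poly_Mapping.keys x. mon 1 j (g (Poly_Mapping.lookup (q_deriv M x) j)))"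
    unfolding lext.simps g_def [symmetric]
    by (rule sum.mono_neutral_left) (auto simp: in_keys_iff lookup_q_deriv g0)
  also have "\<dots> = (\<Sum>j\<in>Poly_Mapping.keys x. mon (of_int j) j (g (Poly_Mapping.lookup x j)))"
    by (simp add: lookup_q_deriv g_scal mon_mon)
  finally have first: "lext (q_deriv M x # xs) F = \<dots>" .
  have "q_deriv M (lext (x # xs) F) = (\<Sum>j\<in>Poly_Mapping.keys x.
      mon 1 j (q_deriv M (g (Poly_Mapping.lookup x j))) + mon (of_int j) j (g (Poly_Mapping.lookup x j)))"
    by (simp add: q_deriv_sum q_deriv_mon g_def)
  also have "\<dots> = lext (x # xs) (\<lambda>vs. q_deriv M (F vs))
      + (\<Sum>i<length xs. lext (x # xs[i := q_deriv M (xs ! i)]) F) + lext (q_deriv M x # xs) F"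
    unfolding IH first
    by (simp add: mon_add mon_sum sum.distrib sum.swap [of _ "Poly_Mapping.keys x"])
  finally show ?case
    by (simp add: sum.lessThan_Suc_shift algebra_simps del: sum.lessThan_Suc lext.simps)
qed

section \<open>Quantum products with further insertions\<close>

text \<open>
The quantum product of the listed classes in the sense of the invariants with markings of arbitrary
modulus: for two classes it is their small quantum product, and further entries are bulk insertions.
\<close>

definition gw_series :: "'v list \<Rightarrow> 'v laurent" where
  "gw_series vs = (\<Sum>A\<in>gw_classes (length vs). Poly_Mapping.single (chern_num M A) (gw_dual M A vs))"

lemma gw_classes_mono: "m \<le> n \<Longrightarrow> gw_classes m \<subseteq> gw_classes n"
proof -
  assume "m \<le> n"
  then have "int (half_dim M) * int m \<le> int (half_dim M) * int n"
    by (intro mult_left_mono) auto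
  then show ?thesis
    unfolding gw_classes_def by auto
qed

lemma gw_series_superset:
  assumes "length vs \<ge> 2" "gw_classes (length vs) \<subseteq> C" "finite C"
  shows "gw_series vs = (\<Sum>A\<in>C. Poly_Mapping.single (chern_num M A) (gw_dual M A vs))"
  unfolding gw_series_def by (rule sum.mono_neutral_left) (use assms gw_dual_eq_0 in auto)

lemma multi_additive_gw_series: "n \<ge> 2 \<Longrightarrow> multi_additive n gw_series"
  unfolding multi_additive_def gw_series_def
  using multi_additiveD [OF multi_additive_gw_dual]
  by (auto simp: single_add sum.distrib)

lemma gw_series_scal:
  "length as + length bs \<ge> 1 \<Longrightarrow> gw_series (as @ scal M c v # bs) = mon c 0 (gw_series (as @ v # bs))"
  by (simp add: gw_series_def gw_dual_scal mon_sum mon_single)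

text \<open>
The divisor axiom for $c_1(M)$: the derivation $q\partial_q$ multiplies the contribution of a class by its
Chern number.
\<close>

lemma q_deriv_gw_series:
  assumes "length vs \<ge> 2"
  shows "q_deriv M (gw_series vs) = gw_series (chern M # vs)"
proof -
  have "gw_classes (length vs) \<subseteq> gw_classes (length (chern M # vs))"
    by (intro gw_classes_mono) simp
  then have "gw_series vs = (\<Sum>A\<in>gw_classes (length (chern M # vs)). Poly_Mapping.single (chern_num M A) (gw_dual M A vs))"
    using assms by (intro gw_series_superset) auto
  then show ?thesis
    using assms by (simp add: q_deriv_sum q_deriv_single gw_series_def gw_dual_divisor)
qed

definition qprod_list :: "'v laurent list \<Rightarrow> 'v laurent" where
  "qprod_list xs = lext xs gw_series"

lemma qmult_eq: "qmult M x y = qprod_list [x, y]"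
proof -
  have "qprod M v w = gw_series [v, w]" for v w
    unfolding qprod_def qprod_class_def gw_series_def
    by (rule sum.mono_neutral_left) (use gw_dual_eq_0 [of "[v, w]"] in auto)
  moreover have "Poly_Mapping.map_key (\<lambda>k. k - i) z = mon 1 i z" for i z
  proof (rule poly_mapping_eqI)
    fix n
    have "inj (\<lambda>k::int. k - i)"
      by (auto intro: injI)
    then show "Poly_Mapping.lookup (Poly_Mapping.map_key (\<lambda>k. k - i) z) n = Poly_Mapping.lookup (mon 1 i z) n"
      by (simp add: map_key.rep_eq lookup_mon)
  qed
  ultimately show ?thesis
    by (simp add: qmult_def qprod_list_def mon_sum mon_mon)
qed

lemma multi_additive_qprod_list: "n \<ge> 2 \<Longrightarrow> multi_additive n qprod_list"
  unfolding qprod_list_def by (intro multi_additive_lext multi_additive_gw_series)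

lemma qprod_list_add:
  "length xs + length ys \<ge> 1 \<Longrightarrow>
    qprod_list (xs @ (x + y) # ys) = qprod_list (xs @ x # ys) + qprod_list (xs @ y # ys)"
  by (rule multi_additiveD [OF multi_additive_qprod_list refl]) simp

lemma qprod_list_mon:
  "length xs + length ys \<ge> 1 \<Longrightarrow> qprod_list (xs @ mon c i x # ys) = mon c i (qprod_list (xs @ x # ys))"
  unfolding qprod_list_def
  by (rule lext_mon) (auto intro!: multi_additive_gw_series gw_series_scal)

lemma qprod_list_swap:
  assumes "x \<in> laurent_deg M d" "even d"
  shows "qprod_list (xs @ y # x # ys) = qprod_list (xs @ x # y # ys)"
  unfolding qprod_list_def
proof (rule lext_swap)
  fix as i u and bs :: "'v list"
  have "Poly_Mapping.lookup x i \<in> coh M (d - 2 * i)" "even (d - 2 * i)"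
    using assms unfolding laurent_deg_def by auto
  then have "gw_dual M A (as @ u # Poly_Mapping.lookup x i # bs) = gw_dual M A (as @ Poly_Mapping.lookup x i # u # bs)" for A
    by (rule gw_dual_swap)
  then show "gw_series (as @ u # Poly_Mapping.lookup x i # bs) = gw_series (as @ Poly_Mapping.lookup x i # u # bs)"
    by (simp add: gw_series_def)
qed

lemma qprod_list_rotate:
  assumes "x \<in> laurent_deg M d" "even d"
  shows "qprod_list (xs @ x # ys) = qprod_list (x # xs @ ys)"
proof (induction xs arbitrary: ys rule: rev_induct)
  case (snoc a xs)
  show ?case
    using qprod_list_swap [OF assms, of xs a ys] snoc [of "a # ys"] by simp
qed simp

lemma list_all2_monomials:
  assumes "list_all2 (\<lambda>y E. y \<in> E) ys (map monomials ds)"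
  obtains ps where "ys = map (\<lambda>p. Poly_Mapping.single (fst p) (snd p)) ps"
    "list_all2 (\<lambda>p d. snd p \<in> coh M (d - 2 * fst p)) ps ds"
proof -
  have "\<exists>ps. ys = map (\<lambda>p. Poly_Mapping.single (fst p) (snd p)) ps \<and>
    list_all2 (\<lambda>p d. snd p \<in> coh M (d - 2 * fst p)) ps ds"
    using assms
  proof (induction ys arbitrary: ds)
    case Nil
    then show ?case by simp
  next
    case (Cons y ys)
    then obtain d ds' where ds: "ds = d # ds'" and y: "y \<in> monomials d"
      and ys: "list_all2 (\<lambda>y E. y \<in> E) ys (map monomials ds')"
      by (cases ds) auto
    from y obtain j v where "y = Poly_Mapping.single j v" "v \<in> coh M (d - 2 * j)"
      by (auto simp: monomials_def)
    moreover obtain ps where "ys = map (\<lambda>p. Poly_Mapping.single (fst p) (snd p)) ps"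
      "list_all2 (\<lambda>p d. snd p \<in> coh M (d - 2 * fst p)) ps ds'"
      using Cons.IH [OF ys] by blast
    ultimately show ?case
      by (intro exI [of _ "(j, v) # ps"]) (simp add: ds)
  qed
  then show thesis
    using that by blast
qed

lemma qprod_list_monomials:
  "length ps \<ge> 2 \<Longrightarrow> qprod_list (map (\<lambda>p. Poly_Mapping.single (fst p) (snd p)) ps)
    = mon 1 (\<Sum>p\<leftarrow>ps. fst p) (gw_series (map snd ps))"
  unfolding qprod_list_def by (intro lext_single multi_additive_gw_series)

lemma qprod_list_deg:
  assumes "list_all2 (\<lambda>x d. x \<in> laurent_deg M d) xs ds" "length xs \<ge> 2"
  shows "qprod_list xs \<in> laurent_deg M (sum_list ds - 2 * (int (length xs) - 2))"
proof (rule multi_additive_induct [OF multi_additive_qprod_list [OF assms(2)], where Es = "map monomials ds"])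
  show "list_all2 (\<lambda>x E. x \<in> add_span E) xs (map monomials ds)"
    using assms(1) unfolding list_all2_map2
    by (rule list_all2_mono) (rule laurent_deg_add_span)
next
  fix ys
  assume ys: "list_all2 (\<lambda>y E. y \<in> E) ys (map monomials ds)"
  then obtain ps where ps: "ys = map (\<lambda>p. Poly_Mapping.single (fst p) (snd p)) ps"
    "list_all2 (\<lambda>p d. snd p \<in> coh M (d - 2 * fst p)) ps ds"
    by (rule list_all2_monomials)
  have len: "length ps = length xs"
    using list_all2_lengthD [OF ps(2)] list_all2_lengthD [OF assms(1)] by simp
  define vs where "vs = map snd ps"
  define J where "J = (\<Sum>p\<leftarrow>ps. fst p)"
  have "\<exists>es. list_all2 (\<lambda>v e. v \<in> coh M e) vs es \<and> sum_list es = sum_list ds - 2 * J"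
    using ps(2) unfolding vs_def J_def
  proof (induction ps arbitrary: ds)
    case (Cons p ps)
    then obtain d ds' where ds: "ds = d # ds'" and p: "snd p \<in> coh M (d - 2 * fst p)"
      and "list_all2 (\<lambda>p d. snd p \<in> coh M (d - 2 * fst p)) ps ds'"
      by (auto simp: list_all2_Cons1)
    then obtain es where "list_all2 (\<lambda>v e. v \<in> coh M e) (map snd ps) es"
      "sum_list es = sum_list ds' - 2 * (\<Sum>p\<leftarrow>ps. fst p)"
      using Cons.IH by blast
    then show ?case
      using p by (intro exI [of _ "(d - 2 * fst p) # es"]) (simp add: ds)
  qed simp
  then obtain es where es: "list_all2 (\<lambda>v e. v \<in> coh M e) vs es" "sum_list es = sum_list ds - 2 * J"
    by blast
  have "gw_series vs \<in> laurent_deg M (sum_list es - 2 * (int (length xs) - 2))"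
    unfolding gw_series_def
  proof (intro laurent_deg_sum laurent_deg_single)
    fix A
    show "gw_dual M A vs \<in> coh M (sum_list es - 2 * (int (length xs) - 2) - 2 * chern_num M A)"
      using gw_dual_coh [OF es(1), of A] assms(2) len by (simp add: vs_def algebra_simps)
  qed
  then have "mon 1 J (gw_series vs) \<in> laurent_deg M (sum_list es - 2 * (int (length xs) - 2) + 2 * J)"
    by (rule laurent_deg_mon)
  moreover have "sum_list es - 2 * (int (length xs) - 2) + 2 * J = sum_list ds - 2 * (int (length xs) - 2)"
    using es(2) by simp
  moreover have "qprod_list ys = mon 1 J (gw_series vs)"
    using len assms(2) unfolding ps(1) by (simp add: qprod_list_monomials J_def vs_def)
  ultimately show "qprod_list ys \<in> laurent_deg M (sum_list ds - 2 * (int (length xs) - 2))"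
    by metis
qed (auto intro: laurent_deg_0 laurent_deg_add)

lemma qprod_list_chern:
  assumes "length xs \<ge> 2"
  shows "qprod_list (Poly_Mapping.single 0 (chern M) # xs) = lext xs (\<lambda>vs. q_deriv M (gw_series vs))"
proof -
  have eq: "lext xs (\<lambda>vs. gw_series (chern M # vs)) = lext xs (\<lambda>vs. q_deriv M (gw_series vs))"
    by (rule lext_cong) (use assms q_deriv_gw_series in auto)
  show ?thesis
  proof (cases "chern M = 0")
    case True
    then have "lext xs (\<lambda>vs. gw_series (chern M # vs)) = 0"
      using multi_additive_0 [OF multi_additive_gw_series, of "Suc (length xs)" "[]"] assms
      by (intro lext_zero) auto
    then show ?thesis
      using True eq by (simp add: qprod_list_def)
  next
    case False
    then show ?thesis
      using eq by (simp add: qprod_list_def)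
  qed
qed

lemma q_deriv_qprod_list:
  assumes "length xs \<ge> 2"
  shows "q_deriv M (qprod_list xs) = qprod_list (Poly_Mapping.single 0 (chern M) # xs)
    + (\<Sum>i<length xs. qprod_list (xs[i := q_deriv M (xs ! i)]))"
proof -
  have "gw_series (as @ scal M c v # bs) = mon c 0 (gw_series (as @ v # bs))"
    if "Suc (length as + length bs) = length xs" for as v bs c
    using that assms by (intro gw_series_scal) simp
  from q_deriv_lext [OF multi_additive_gw_series [OF assms] this]
  show ?thesis
    unfolding qprod_list_chern [OF assms] unfolding qprod_list_def by blast
qed

lemma chern_num_add: "chern_num M (A + B) = chern_num M A + chern_num M B"
proof -
  obtain r where r: "\<And>A. of_int (chern_num M A) = r * area M A"
    using monotone by blast
  have "(of_int (chern_num M (A + B)) :: real) = of_int (chern_num M A + chern_num M B)"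
    by (simp add: r area_add distrib_left)
  then show ?thesis
    using of_int_eq_iff by blast
qed

lemma qprod_list_unit: "qprod_list [Poly_Mapping.single 0 (coh_unit M), x] = x"
proof -
  have gwc: "gw_series [coh_unit M, v] = Poly_Mapping.single 0 v" for v
  proof -
    have "chern_num M 0 = 0"
      using chern_num_add [of 0 0] by simp
    moreover have "gw_series [coh_unit M, v] =
      (\<Sum>A\<in>insert 0 (gw_classes 2). Poly_Mapping.single (chern_num M A) (gw_dual M A [coh_unit M, v]))"
      by (rule gw_series_superset) (auto simp: numeral_2_eq_2)
    moreover have "\<dots> = (\<Sum>A\<in>insert 0 (gw_classes 2). if A = 0 then Poly_Mapping.single (chern_num M A) v else 0)"
      by (intro sum.cong) (auto simp: gw_dual_unit)
    moreover have "\<dots> = Poly_Mapping.single (chern_num M 0) v"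
      by (subst sum.delta) auto
    ultimately show ?thesis by simp
  qed
  show ?thesis
  proof (cases "coh_unit M = 0")
    case True
    have "v = 0" for v :: 'v
      using cup_unit [of v] True by simp
    then have "x = 0"
      by (intro poly_mapping_eqI) simp
    then show ?thesis
      by (simp add: qprod_list_def)
  next
    case False
    then show ?thesis
      by (simp add: qprod_list_def gwc mon_single sum_singles)
  qed
qed

lemma finite_splittings: "finite {B. gw_class M B \<and> gw_class M (A - B)}"
proof (rule finite_subset [OF _ gw_compact [of "area M A"]], rule subsetI)
  fix B
  assume "B \<in> {B. gw_class M B \<and> gw_class M (A - B)}"
  then have "gw_class M B" "gw_class M (A - B)" by auto
  have "area M 0 = 0"
    using area_add [of 0 0] by simp
  then have "area M (A - B) \<ge> 0"
    using gw_energy [OF \<open>gw_class M (A - B)\<close>] by auto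
  then show "B \<in> {B. gw_class M B \<and> area M B \<le> area M A}"
    using area_add [of B "A - B"] \<open>gw_class M B\<close> by simp
qed

text \<open>
Collects the pairs of classes with a given sum. The Chern number is additive, so such pairs contribute to the same
power of $q$, and the inner sum takes the shape that occurs in the splitting axiom.
\<close>

lemma sum_over_pairs_of_classes:
  fixes f :: "'h \<Rightarrow> 'h \<Rightarrow> 'v"
  assumes "\<And>B C. B \<notin> gw_classes k \<or> C \<notin> gw_classes k \<Longrightarrow> f B C = 0"
  shows "(\<Sum>B\<in>gw_classes k. \<Sum>C\<in>gw_classes k. Poly_Mapping.single (chern_num M B + chern_num M C) (f B C))
    = (\<Sum>A\<in>(\<lambda>(B, C). B + C) ` (gw_classes k \<times> gw_classes k). Poly_Mapping.single (chern_num M A)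
        (\<Sum>B | gw_class M B \<and> gw_class M (A - B). f B (A - B)))"
proof -
  define P where "P = gw_classes k \<times> gw_classes k"
  have fin: "finite P" by (simp add: P_def)
  define s where "s = (\<lambda>(B, C). Poly_Mapping.single (chern_num M B + chern_num M C) (f B C))"
  have "(\<Sum>B\<in>gw_classes k. \<Sum>C\<in>gw_classes k. Poly_Mapping.single (chern_num M B + chern_num M C) (f B C))
      = (\<Sum>p\<in>P. s p)"
    by (simp add: P_def s_def sum.cartesian_product)
  also have "\<dots> = (\<Sum>A\<in>(\<lambda>(B, C). B + C) ` P. \<Sum>p | p \<in> P \<and> (\<lambda>(B, C). B + C) p = A. s p)"
    by (rule sum.image_gen [OF fin])
  also have "\<dots> = (\<Sum>A\<in>(\<lambda>(B, C). B + C) ` P. Poly_Mapping.single (chern_num M A)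
        (\<Sum>B | gw_class M B \<and> gw_class M (A - B). f B (A - B)))"
  proof (rule sum.cong [OF refl])
    fix A
    have "{p. p \<in> P \<and> (\<lambda>(B, C). B + C) p = A} = (\<lambda>B. (B, A - B)) ` {B. B \<in> gw_classes k \<and> A - B \<in> gw_classes k}"
      by (auto simp: P_def image_iff)
    then have "(\<Sum>p | p \<in> P \<and> (\<lambda>(B, C). B + C) p = A. s p)
        = (\<Sum>B | B \<in> gw_classes k \<and> A - B \<in> gw_classes k. s (B, A - B))"
      by (simp add: sum.reindex inj_on_def)
    also have "\<dots> = (\<Sum>B | gw_class M B \<and> gw_class M (A - B). s (B, A - B))"
    proof (rule sum.mono_neutral_left [OF finite_splittings])
      show "\<forall>B\<in>{B. gw_class M B \<and> gw_class M (A - B)} - {B. B \<in> gw_classes k \<and> A - B \<in> gw_classes k}.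
          s (B, A - B) = 0"
        using assms by (auto simp: s_def)
    qed (auto simp: gw_classes_def)
    also have "\<dots> = (\<Sum>B | gw_class M B \<and> gw_class M (A - B). Poly_Mapping.single (chern_num M A) (f B (A - B)))"
      by (simp add: s_def chern_num_add [symmetric])
    also have "\<dots> = Poly_Mapping.single (chern_num M A) (\<Sum>B | gw_class M B \<and> gw_class M (A - B). f B (A - B))"
    proof -
      have single_sum: "Poly_Mapping.single c (sum h I) = (\<Sum>i\<in>I. Poly_Mapping.single c (h i))"
        for c :: int and h :: "'h \<Rightarrow> 'v" and I
        by (induction I rule: infinite_finite_induct) (auto simp: single_add)
      show ?thesis by (simp only: single_sum)
    qed
    finally show "(\<Sum>p | p \<in> P \<and> (\<lambda>(B, C). B + C) p = A. s p) = \<dots>" .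
  qed
  finally show ?thesis
    by (simp only: P_def)
qed

section \<open>The splitting axiom\<close>

text \<open>
The two sides of the splitting axiom, for Laurent polynomials: the positions in \<open>I\<close> go into the inner product.
\<close>

definition left_split :: "'v laurent \<Rightarrow> 'v laurent \<Rightarrow> 'v laurent \<Rightarrow> 'v laurent list \<Rightarrow> nat set \<Rightarrow> 'v laurent" where
  "left_split x y z S I = qprod_list (qprod_list (x # y # nths S I) # z # nths S (- I))"

definition right_split :: "'v laurent \<Rightarrow> 'v laurent \<Rightarrow> 'v laurent \<Rightarrow> 'v laurent list \<Rightarrow> nat set \<Rightarrow> 'v laurent" where
  "right_split x y z S I = qprod_list (x # qprod_list (y # z # nths S I) # nths S (- I))"

lemma split_add:
  shows "left_split (x + x') y z S I = left_split x y z S I + left_split x' y z S I"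
    and "left_split x (y + y') z S I = left_split x y z S I + left_split x y' z S I"
    and "left_split x y (z + z') S I = left_split x y z S I + left_split x y z' S I"
    and "left_split x y z (as @ (s + s') # bs) I = left_split x y z (as @ s # bs) I + left_split x y z (as @ s' # bs) I"
    and "right_split (x + x') y z S I = right_split x y z S I + right_split x' y z S I"
    and "right_split x (y + y') z S I = right_split x y z S I + right_split x y' z S I"
    and "right_split x y (z + z') S I = right_split x y z S I + right_split x y z' S I"
    and "right_split x y z (as @ (s + s') # bs) I = right_split x y z (as @ s # bs) I + right_split x y z (as @ s' # bs) I"
proof -
  have 1: "qprod_list ((x + x') # y # S) = qprod_list (x # y # S) + qprod_list (x' # y # S)" for x x' y S
    using qprod_list_add [of "[]" "y # S"] by simp
  have 2: "qprod_list (x # (y + y') # S) = qprod_list (x # y # S) + qprod_list (x # y' # S)" for x y y' S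
    using qprod_list_add [of "[x]" S] by simp
  have 3: "qprod_list (x # y # as @ (s + s') # bs) = qprod_list (x # y # as @ s # bs) + qprod_list (x # y # as @ s' # bs)"
    for x y as s s' bs
    using qprod_list_add [of "x # y # as" bs] by simp
  show "left_split (x + x') y z S I = left_split x y z S I + left_split x' y z S I"
    "left_split x (y + y') z S I = left_split x y z S I + left_split x y' z S I"
    "left_split x y (z + z') S I = left_split x y z S I + left_split x y z' S I"
    "right_split (x + x') y z S I = right_split x y z S I + right_split x' y z S I"
    "right_split x (y + y') z S I = right_split x y z S I + right_split x y' z S I"
    "right_split x y (z + z') S I = right_split x y z S I + right_split x y z' S I"
    by (simp_all add: left_split_def right_split_def 1 2)
  show "left_split x y z (as @ (s + s') # bs) I = left_split x y z (as @ s # bs) I + left_split x y z (as @ s' # bs) I"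
    "right_split x y z (as @ (s + s') # bs) I = right_split x y z (as @ s # bs) I + right_split x y z (as @ s' # bs) I"
    by (cases "length as \<in> I"; simp add: left_split_def right_split_def nths_middle 1 2 3)+
qed

text \<open>
Both sides of the splitting axiom as one function of the list of all arguments, so that it can be checked on
monomials.
\<close>

definition wdvv_defect :: "'v laurent list \<Rightarrow> 'v laurent" where
  "wdvv_defect xs = (\<Sum>I\<in>Pow {..<length xs - 3}.
     left_split (xs ! 0) (xs ! 1) (xs ! 2) (drop 3 xs) I - right_split (xs ! 0) (xs ! 1) (xs ! 2) (drop 3 xs) I)"

lemma wdvv_defect_Cons:
  "wdvv_defect (x # y # z # S) = (\<Sum>I\<in>Pow {..<length S}. left_split x y z S I - right_split x y z S I)"
  by (simp add: wdvv_defect_def numeral_2_eq_2 numeral_3_eq_3)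

lemma multi_additive_wdvv_defect:
  assumes "n \<ge> 3"
  shows "multi_additive n wdvv_defect"
  unfolding multi_additive_def
proof (intro allI impI)
  fix xs ys :: "'v laurent list" and x y
  assume n: "Suc (length xs + length ys) = n"
  consider y' z S where "xs = []" "ys = y' # z # S" | x' z S where "xs = [x']" "ys = z # S"
    | x' y' S where "xs = [x', y']" "ys = S" | x' y' z as where "xs = x' # y' # z # as"
  proof (cases xs)
    case Nil
    moreover from Nil obtain y' z S where "ys = y' # z # S"
      using n assms by (cases ys; cases "tl ys") auto
    ultimately show ?thesis using that by blast
  next
    case (Cons x' xs')
    note xs = this
    show ?thesis
    proof (cases xs')
      case Nil
      moreover from Nil obtain z S where "ys = z # S"
        using n assms xs by (cases ys) auto
      ultimately show ?thesis using that xs by blast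
    next
      case (Cons y' xs'')
      then show ?thesis using that xs by (cases xs'') auto
    qed
  qed
  then show "wdvv_defect (xs @ (x + y) # ys) = wdvv_defect (xs @ x # ys) + wdvv_defect (xs @ y # ys)"
    by cases (simp_all add: wdvv_defect_Cons split_add sum.distrib sum_subtractf algebra_simps)
qed

abbreviation monomial :: "int \<times> 'v \<Rightarrow> 'v laurent" where
  "monomial p \<equiv> Poly_Mapping.single (fst p) (snd p)"

lemma qprod_list_gw_series:
  assumes "length us \<ge> 2" "length us \<le> k" "length ps + length qs \<ge> 1"
  shows "qprod_list (map monomial ps @ gw_series us # map monomial qs)
    = mon 1 ((\<Sum>p\<leftarrow>ps. fst p) + (\<Sum>p\<leftarrow>qs. fst p))
       (\<Sum>B\<in>gw_classes k. mon 1 (chern_num M B) (gw_series (map snd ps @ gw_dual M B us # map snd qs)))"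
proof -
  have "gw_series us = (\<Sum>B\<in>gw_classes k. Poly_Mapping.single (chern_num M B) (gw_dual M B us))"
    using assms gw_classes_mono by (intro gw_series_superset) auto
  moreover have "qprod_list (map monomial ps @ sum f C # map monomial qs) = (\<Sum>B\<in>C. qprod_list (map monomial ps @ f B # map monomial qs))"
    if "finite C" for f and C :: "'h set"
    using that
  proof (induction C rule: finite_induct)
    case empty
    show ?case
      using multi_additive_0 [OF multi_additive_qprod_list, of "Suc (length ps + length qs)" "map monomial ps" "map monomial qs"]
        assms(3) by simp
  next
    case (insert B C)
    then show ?case
      using assms(3) by (simp add: qprod_list_add)
  qed
  moreover have "qprod_list (map monomial ps @ Poly_Mapping.single c w # map monomial qs)
      = mon 1 ((\<Sum>p\<leftarrow>ps. fst p) + (\<Sum>p\<leftarrow>qs. fst p)) (mon 1 c (gw_series (map snd ps @ w # map snd qs)))" for c w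
    using qprod_list_monomials [of "ps @ (c, w) # qs"] assms(3) by (simp add: mon_mon algebra_simps)
  ultimately show ?thesis
    by (simp add: mon_sum)
qed

lemma mon_gw_series:
  assumes "length vs \<ge> 2" "length vs \<le> k"
  shows "mon 1 c (gw_series vs) = (\<Sum>C\<in>gw_classes k. Poly_Mapping.single (c + chern_num M C) (gw_dual M C vs))"
proof -
  have "gw_series vs = (\<Sum>C\<in>gw_classes k. Poly_Mapping.single (chern_num M C) (gw_dual M C vs))"
    using assms gw_classes_mono by (intro gw_series_superset) auto
  then show ?thesis
    by (simp add: mon_sum mon_single)
qed

lemma wdvv_defect_monomials:
  assumes "\<And>p. p \<in> set ps \<Longrightarrow> \<exists>d. even d \<and> snd p \<in> coh M d"
  shows "wdvv_defect (monomial p1 # monomial p2 # monomial p3 # map monomial ps) = 0"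
proof -
  define k where "k = length ps + 3"
  define S where "S = map snd ps"
  obtain x y z where xyz: "x = snd p1" "y = snd p2" "z = snd p3" by blast
  define J where "J = fst p1 + fst p2 + fst p3 + (\<Sum>p\<leftarrow>ps. fst p)"
  define f where "f B C = (\<Sum>I\<in>Pow {..<length S}. gw_dual M C (gw_dual M B (x # y # nths S I) # z # nths S (- I)))" for B C
  define g where "g B C = (\<Sum>I\<in>Pow {..<length S}. gw_dual M C (x # gw_dual M B (y # z # nths S I) # nths S (- I)))" for B C
  have len: "length (nths S I) \<le> k - 3" for I
    using length_nths_le [of S I] by (simp add: S_def k_def)
  have small: "length (nths ps I) \<le> k - 3" for I
    using length_nths_le [of ps I] by (simp add: k_def)
  have k3: "k \<ge> 3" by (simp add: k_def)
  have len': "Suc (Suc (length (nths S I))) \<le> k" "Suc (Suc (length (nths ps I))) \<le> k" for I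
    using len [of I] small [of I] k3 by linarith+
  have J_split: "(\<Sum>p\<leftarrow>nths ps I. fst p) + (\<Sum>p\<leftarrow>nths ps (- I). fst p) = (\<Sum>p\<leftarrow>ps. fst p)" for I
    by (rule sum_list_nths)
  \<comment> \<open>On monomials the total power \<open>J\<close> of $q$ does not depend on \<open>I\<close>, so it can be split off.\<close>
  have left: "left_split (monomial p1) (monomial p2) (monomial p3) (map monomial ps) I
      = mon 1 J (\<Sum>B\<in>gw_classes k. \<Sum>C\<in>gw_classes k. Poly_Mapping.single (chern_num M B + chern_num M C)
          (gw_dual M C (gw_dual M B (x # y # nths S I) # z # nths S (- I))))" for I
  proof -
    have "qprod_list (monomial p1 # monomial p2 # nths (map monomial ps) I)
        = mon 1 (fst p1 + fst p2 + (\<Sum>p\<leftarrow>nths ps I. fst p)) (gw_series (x # y # nths S I))"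
      using qprod_list_monomials [of "p1 # p2 # nths ps I"] by (simp add: xyz S_def nths_map algebra_simps)
    then have "left_split (monomial p1) (monomial p2) (monomial p3) (map monomial ps) I
        = mon 1 (fst p1 + fst p2 + (\<Sum>p\<leftarrow>nths ps I. fst p))
           (qprod_list (gw_series (x # y # nths S I) # monomial p3 # map monomial (nths ps (- I))))"
      using qprod_list_mon [of "[]"] by (simp add: left_split_def nths_map)
    also have "qprod_list (gw_series (x # y # nths S I) # monomial p3 # map monomial (nths ps (- I)))
        = mon 1 (fst p3 + (\<Sum>p\<leftarrow>nths ps (- I). fst p))
       (\<Sum>B\<in>gw_classes k. mon 1 (chern_num M B) (gw_series (gw_dual M B (x # y # nths S I) # z # nths S (- I))))"
      using qprod_list_gw_series [of "x # y # nths S I" k "[]" "p3 # nths ps (- I)"] len' [of I]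
      by (simp add: xyz S_def nths_map)
    also have "mon 1 (fst p1 + fst p2 + (\<Sum>p\<leftarrow>nths ps I. fst p)) (mon 1 (fst p3 + (\<Sum>p\<leftarrow>nths ps (- I). fst p)) w) = mon 1 J w" for w
      unfolding mon_mon J_def J_split [of I, symmetric] by (simp add: algebra_simps)
    finally show ?thesis
      using len' [of "- I"] by (simp add: mon_gw_series)
  qed
  have right: "right_split (monomial p1) (monomial p2) (monomial p3) (map monomial ps) I
      = mon 1 J (\<Sum>B\<in>gw_classes k. \<Sum>C\<in>gw_classes k. Poly_Mapping.single (chern_num M B + chern_num M C)
          (gw_dual M C (x # gw_dual M B (y # z # nths S I) # nths S (- I))))" for I
  proof -
    have "qprod_list (monomial p2 # monomial p3 # nths (map monomial ps) I)
        = mon 1 (fst p2 + fst p3 + (\<Sum>p\<leftarrow>nths ps I. fst p)) (gw_series (y # z # nths S I))"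
      using qprod_list_monomials [of "p2 # p3 # nths ps I"] by (simp add: xyz S_def nths_map algebra_simps)
    then have "right_split (monomial p1) (monomial p2) (monomial p3) (map monomial ps) I
        = mon 1 (fst p2 + fst p3 + (\<Sum>p\<leftarrow>nths ps I. fst p))
           (qprod_list (monomial p1 # gw_series (y # z # nths S I) # map monomial (nths ps (- I))))"
      using qprod_list_mon [of "[_]"] by (simp add: right_split_def nths_map)
    also have "qprod_list (monomial p1 # gw_series (y # z # nths S I) # map monomial (nths ps (- I)))
        = mon 1 (fst p1 + (\<Sum>p\<leftarrow>nths ps (- I). fst p))
       (\<Sum>B\<in>gw_classes k. mon 1 (chern_num M B) (gw_series (x # gw_dual M B (y # z # nths S I) # nths S (- I))))"
      using qprod_list_gw_series [of "y # z # nths S I" k "[p1]" "nths ps (- I)"] len' [of I]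
      by (simp add: xyz S_def nths_map)
    also have "mon 1 (fst p2 + fst p3 + (\<Sum>p\<leftarrow>nths ps I. fst p)) (mon 1 (fst p1 + (\<Sum>p\<leftarrow>nths ps (- I). fst p)) w) = mon 1 J w" for w
      unfolding mon_mon J_def J_split [of I, symmetric] by (simp add: algebra_simps)
    finally show ?thesis
      using len' [of "- I"] by (simp add: mon_gw_series)
  qed
  have single_sum: "Poly_Mapping.single c (sum h I) = (\<Sum>i\<in>I. Poly_Mapping.single c (h i))"
    for c :: int and h :: "nat set \<Rightarrow> 'v" and I
    by (induction I rule: infinite_finite_induct) (auto simp: single_add)
  have f0: "f B C = 0" if "B \<notin> gw_classes k \<or> C \<notin> gw_classes k" for B C
  proof -
    have "gw_dual M C (gw_dual M B (x # y # nths S I) # z # nths S (- I)) = 0" for I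
    proof (cases "C \<in> gw_classes k")
      case True
      then have "gw_dual M B (x # y # nths S I) = 0"
        using that gw_classes_mono len' [of I] by (intro gw_dual_eq_0) auto
      then show ?thesis
        using multi_additive_0 [OF multi_additive_gw_dual refl, of "[]" "z # nths S (- I)"] by simp
    next
      case False
      then show ?thesis
        using gw_classes_mono len' [of "- I"] by (intro gw_dual_eq_0) auto
    qed
    then show ?thesis by (simp add: f_def)
  qed
  have g0: "g B C = 0" if "B \<notin> gw_classes k \<or> C \<notin> gw_classes k" for B C
  proof -
    have "gw_dual M C (x # gw_dual M B (y # z # nths S I) # nths S (- I)) = 0" for I
    proof (cases "C \<in> gw_classes k")
      case True
      then have "gw_dual M B (y # z # nths S I) = 0"
        using that gw_classes_mono len' [of I] by (intro gw_dual_eq_0) auto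
      then show ?thesis
        using multi_additive_0 [OF multi_additive_gw_dual refl, of "[x]" "nths S (- I)"] by simp
    next
      case False
      then show ?thesis
        using gw_classes_mono len' [of "- I"] by (intro gw_dual_eq_0) auto
    qed
    then show ?thesis by (simp add: g_def)
  qed
  have fg: "(\<Sum>B | gw_class M B \<and> gw_class M (A - B). f B (A - B)) = (\<Sum>B | gw_class M B \<and> gw_class M (A - B). g B (A - B))" for A
    unfolding f_def g_def
    by (rule gw_splitting) (use assms in \<open>auto simp: S_def\<close>)
  have "(\<Sum>I\<in>Pow {..<length ps}. left_split (monomial p1) (monomial p2) (monomial p3) (map monomial ps) I)
      = mon 1 J (\<Sum>B\<in>gw_classes k. \<Sum>C\<in>gw_classes k. Poly_Mapping.single (chern_num M B + chern_num M C) (f B C))"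
    unfolding left mon_sum [symmetric] f_def single_sum
    by (subst sum.swap, subst sum.swap) (simp add: S_def)
  also have "\<dots> = mon 1 J (\<Sum>B\<in>gw_classes k. \<Sum>C\<in>gw_classes k. Poly_Mapping.single (chern_num M B + chern_num M C) (g B C))"
    using sum_over_pairs_of_classes [of k f, OF f0] sum_over_pairs_of_classes [of k g, OF g0] fg by simp
  also have "\<dots> = (\<Sum>I\<in>Pow {..<length ps}. right_split (monomial p1) (monomial p2) (monomial p3) (map monomial ps) I)"
    unfolding right mon_sum [symmetric] g_def single_sum
    by (subst sum.swap, subst sum.swap) (simp add: S_def)
  finally show ?thesis
    by (simp add: wdvv_defect_Cons sum_subtractf)
qed

text \<open>
Degree 0 in \<open>S\<close> ensures that the coefficients of all powers of $q$ have even degree, as the splitting axiom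
requires.
\<close>

lemma wdvv:
  assumes "set S \<subseteq> laurent_deg M 0"
  shows "(\<Sum>I\<in>Pow {..<length S}. left_split x y z S I) = (\<Sum>I\<in>Pow {..<length S}. right_split x y z S I)"
proof -
  let ?U = "\<Union>d. monomials d"
  let ?Es = "?U # ?U # ?U # replicate (length S) (monomials 0)"
  have "wdvv_defect (x # y # z # S) \<in> {0}"
  proof (rule multi_additive_induct [OF multi_additive_wdvv_defect, where Es = ?Es])
    have "list_all2 (\<lambda>x E. x \<in> add_span E) S (replicate (length S) (monomials 0))"
      using assms by (auto simp: list_all2_conv_all_nth subset_iff intro!: laurent_deg_add_span)
    then show "list_all2 (\<lambda>x E. x \<in> add_span E) (x # y # z # S) ?Es"
      by (simp add: add_span_monomials)
  next
    fix ys
    assume "list_all2 (\<lambda>y E. y \<in> E) ys ?Es"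
    then obtain x' y' z' T where ys: "ys = x' # y' # z' # T"
      and xyz: "x' \<in> ?U" "y' \<in> ?U" "z' \<in> ?U" and "list_all2 (\<lambda>y E. y \<in> E) T (replicate (length S) (monomials 0))"
      unfolding list_all2_Cons2 by blast
    then have "list_all2 (\<lambda>y E. y \<in> E) T (map monomials (replicate (length S) 0))"
      by simp
    then obtain ps where ps: "T = map monomial ps"
      "list_all2 (\<lambda>p d. snd p \<in> coh M (d - 2 * fst p)) ps (replicate (length S) 0)"
      by (rule list_all2_monomials)
    have "\<exists>d. even d \<and> snd p \<in> coh M d" if p: "p \<in> set ps" for p
    proof -
      obtain i where "i < length ps" "p = ps ! i"
        using p by (metis in_set_conv_nth)
      then have "snd p \<in> coh M (0 - 2 * fst p)"
        using list_all2_nthD [OF ps(2)] list_all2_lengthD [OF ps(2)] by fastforce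
      then show ?thesis
        by (intro exI [of _ "0 - 2 * fst p"]) auto
    qed
    moreover have mono: "\<exists>p. w = monomial p" if w: "w \<in> ?U" for w
    proof -
      obtain j v where "w = Poly_Mapping.single j v"
        using w by (auto simp: monomials_def)
      then have "w = monomial (j, v)" by simp
      then show ?thesis ..
    qed
    obtain p1 p2 p3 where "x' = monomial p1" "y' = monomial p2" "z' = monomial p3"
      using mono [OF xyz(1)] mono [OF xyz(2)] mono [OF xyz(3)] by (elim exE)
    ultimately show "wdvv_defect ys \<in> {0}"
      using wdvv_defect_monomials [of ps p1 p2 p3] unfolding ys ps(1) by simp
  qed auto
  then show ?thesis
    by (simp add: wdvv_defect_Cons sum_subtractf)
qed

section \<open>The flat connection in the direction of an idempotent\<close>

lemma laurent_deg_diff: "x \<in> laurent_deg M d \<Longrightarrow> y \<in> laurent_deg M d \<Longrightarrow> x - y \<in> laurent_deg M d"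
  using V.subspace_diff [OF coh_subspace] by (simp add: laurent_deg_def lookup_minus)

text \<open>
Linear operators over Laurent polynomials that lower the degree by \<open>2n\<close>. The derivation $q\partial_q$ is not among
them, but the deformed idempotents are, because they are built only from products.
\<close>

definition lin_ops :: "nat \<Rightarrow> 'v laurent endo set" where
  "lin_ops n = {f. (\<forall>c i x. app f (mon c i x) = mon c i (app f x)) \<and>
     (\<forall>d. \<forall>x\<in>laurent_deg M d. app f x \<in> laurent_deg M (d - 2 * int n))}"

lemma mon_diff: "mon c i (x - y) = mon c i x - mon c i y"
  using mon_add [of c i "x - y" y] by (simp add: algebra_simps)

sublocale ops: graded_subring lin_ops
proof
  fix f g :: "'v laurent endo" and m n
  show "0 \<in> lin_ops n" "1 \<in> lin_ops 0"
    by (auto simp: lin_ops_def laurent_deg_0)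
  show "f - g \<in> lin_ops n" if "f \<in> lin_ops n" "g \<in> lin_ops n"
    using that by (auto simp: lin_ops_def app_minus mon_diff laurent_deg_diff)
  show "f * g \<in> lin_ops (m + n)" if fg: "f \<in> lin_ops m" "g \<in> lin_ops n"
  proof -
    have "app f (app g x) \<in> laurent_deg M (d - 2 * int (m + n))" if "x \<in> laurent_deg M d" for d x
    proof -
      have "app f (app g x) \<in> laurent_deg M ((d - 2 * int n) - 2 * int m)"
        using fg that by (auto simp: lin_ops_def)
      then show ?thesis by (simp add: algebra_simps)
    qed
    then show ?thesis
      using fg by (auto simp: lin_ops_def app_times)
  qed
qed

lemma app_of_nat: "app (of_nat n) x = mon (of_nat n) 0 x"
  by (induction n) (simp_all add: app_plus mon_add_left)

lemma sum_const_mon: "finite I \<Longrightarrow> (\<Sum>i\<in>I. w) = mon (of_nat (card I)) 0 w"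
  by (induction I rule: finite_induct) (auto simp: mon_add_left)

lemma sum_Pow_card:
  fixes h :: "nat \<Rightarrow> 'v laurent"
  shows "(\<Sum>I\<in>Pow {..<l}. h (card I)) = (\<Sum>i=0..l. mon (of_nat (l choose i)) 0 (h i))"
proof -
  have "(\<Sum>I\<in>Pow {..<l}. h (card I)) = (\<Sum>i\<in>card ` Pow {..<l}. \<Sum>I | I \<in> Pow {..<l} \<and> card I = i. h (card I))"
    by (rule sum.image_gen) simp
  also have "\<dots> = (\<Sum>i=0..l. \<Sum>I | I \<in> Pow {..<l} \<and> card I = i. h (card I))"
  proof (rule sum.mono_neutral_left)
    show "card ` Pow {..<l} \<subseteq> {0..l}"
      using card_mono [of "{..<l}"] by auto
    show "\<forall>i\<in>{0..l} - card ` Pow {..<l}. (\<Sum>I | I \<in> Pow {..<l} \<and> card I = i. h (card I)) = 0"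
      by (auto intro!: sum.neutral)
  qed simp
  also have "\<dots> = (\<Sum>i=0..l. mon (of_nat (l choose i)) 0 (h i))"
  proof (rule sum.cong [OF refl])
    fix i
    have "(\<Sum>I | I \<in> Pow {..<l} \<and> card I = i. h (card I)) = (\<Sum>I | I \<subseteq> {..<l} \<and> card I = i. h i)"
      by (rule sum.cong) auto
    also have "\<dots> = mon (of_nat (l choose i)) 0 (h i)"
      using n_subsets [of "{..<l}" i] by (subst sum_const_mon) auto
    finally show "(\<Sum>I | I \<in> Pow {..<l} \<and> card I = i. h (card I)) = mon (of_nat (l choose i)) 0 (h i)" .
  qed
  finally show ?thesis .
qed

text \<open>
The coefficient of $s^l$ in the deformed product $x \ast_{se} y$.
\<close>

definition qprod_taylor :: "'v laurent \<Rightarrow> nat \<Rightarrow> 'v laurent \<Rightarrow> 'v laurent \<Rightarrow> 'v laurent" where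
  "qprod_taylor e l x y = mon (inverse (fact l)) 0 (qprod_list (x # y # replicate l e))"

lemma qprod_list_taylor: "qprod_list (x # y # replicate l e) = mon (fact l) 0 (qprod_taylor e l x y)"
  by (simp add: qprod_taylor_def mon_mon)

lemma qprod_taylor_add_left: "qprod_taylor e l (x + x') y = qprod_taylor e l x y + qprod_taylor e l x' y"
  and qprod_taylor_add: "qprod_taylor e l x (y + y') = qprod_taylor e l x y + qprod_taylor e l x y'"
  and qprod_taylor_mon_left: "qprod_taylor e l (mon c i x) y = mon c i (qprod_taylor e l x y)"
  and qprod_taylor_mon: "qprod_taylor e l x (mon c i y) = mon c i (qprod_taylor e l x y)"
  using qprod_list_add [of "[]" "y # replicate l e" x x'] qprod_list_add [of "[x]" "replicate l e" y y']
    qprod_list_mon [of "[]" "y # replicate l e" c i x] qprod_list_mon [of "[x]" "replicate l e" c i y]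
  by (simp_all add: qprod_taylor_def mon_add mon_commute)

lemma qprod_taylor_commute:
  "x \<in> laurent_deg M d \<Longrightarrow> even d \<Longrightarrow> qprod_taylor e l y x = qprod_taylor e l x y"
  using qprod_list_swap [of x d "[]" y "replicate l e"] by (simp add: qprod_taylor_def)

text \<open>
The coefficient of $s^l$ in associativity of the deformed product. In the splitting axiom with $l$ equal insertions,
the $\binom{l}{i}$ subsets of size $i$ give the same term, which accounts for the factorials.
\<close>

lemma qprod_taylor_assoc:
  assumes e: "e \<in> laurent_deg M 0"
  shows "(\<Sum>i=0..l. qprod_taylor e (l - i) (qprod_taylor e i x y) z)
    = (\<Sum>i=0..l. qprod_taylor e (l - i) x (qprod_taylor e i y z))"
proof -
  have card_compl: "card {i. i < l \<and> i \<in> - I} = l - card I" if "I \<subseteq> {..<l}" for I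
  proof -
    have "{i. i < l \<and> i \<in> - I} = {..<l} - I" by auto
    then show ?thesis
      using that by (simp add: card_Diff_subset finite_subset)
  qed
  have card_eq: "card {i. i < l \<and> i \<in> I} = card I" if "I \<subseteq> {..<l}" for I
    using that by (intro arg_cong [where f = card]) auto
  have coeff: "of_nat (l choose i) * (fact i * fact (l - i)) = (fact l :: Qbar)" if "i \<le> l" for i
    using binomial_fact_lemma [OF that] by (metis mult.commute of_nat_fact of_nat_mult)
  have left: "(\<Sum>I\<in>Pow {..<l}. left_split x y z (replicate l e) I)
      = mon (fact l) 0 (\<Sum>i=0..l. qprod_taylor e (l - i) (qprod_taylor e i x y) z)"
  proof -
    have "(\<Sum>I\<in>Pow {..<l}. left_split x y z (replicate l e) I)
        = (\<Sum>I\<in>Pow {..<l}. mon (fact (card I) * fact (l - card I)) 0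
            (qprod_taylor e (l - card I) (qprod_taylor e (card I) x y) z))"
    proof (rule sum.cong [OF refl])
      fix I
      assume "I \<in> Pow {..<l}"
      then show "left_split x y z (replicate l e) I = mon (fact (card I) * fact (l - card I)) 0
            (qprod_taylor e (l - card I) (qprod_taylor e (card I) x y) z)"
        by (simp only: Pow_iff left_split_def nths_replicate card_compl card_eq qprod_list_taylor
            qprod_taylor_mon_left mon_mon) (simp add: mult.commute)
    qed
    also have "\<dots> = (\<Sum>i=0..l. mon (of_nat (l choose i)) 0 (mon (fact i * fact (l - i)) 0
            (qprod_taylor e (l - i) (qprod_taylor e i x y) z)))"
      by (rule sum_Pow_card)
    also have "\<dots> = (\<Sum>i=0..l. mon (fact l) 0 (qprod_taylor e (l - i) (qprod_taylor e i x y) z))"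
      by (intro sum.cong refl) (simp add: mon_mon coeff)
    finally show ?thesis
      by (simp add: mon_sum)
  qed
  have right: "(\<Sum>I\<in>Pow {..<l}. right_split x y z (replicate l e) I)
      = mon (fact l) 0 (\<Sum>i=0..l. qprod_taylor e (l - i) x (qprod_taylor e i y z))"
  proof -
    have "(\<Sum>I\<in>Pow {..<l}. right_split x y z (replicate l e) I)
        = (\<Sum>I\<in>Pow {..<l}. mon (fact (card I) * fact (l - card I)) 0
            (qprod_taylor e (l - card I) x (qprod_taylor e (card I) y z)))"
    proof (rule sum.cong [OF refl])
      fix I
      assume "I \<in> Pow {..<l}"
      then show "right_split x y z (replicate l e) I = mon (fact (card I) * fact (l - card I)) 0
            (qprod_taylor e (l - card I) x (qprod_taylor e (card I) y z))"
        by (simp only: Pow_iff right_split_def nths_replicate card_compl card_eq qprod_list_taylor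
            qprod_taylor_mon mon_mon) (simp add: mult.commute)
    qed
    also have "\<dots> = (\<Sum>i=0..l. mon (of_nat (l choose i)) 0 (mon (fact i * fact (l - i)) 0
            (qprod_taylor e (l - i) x (qprod_taylor e i y z))))"
      by (rule sum_Pow_card)
    also have "\<dots> = (\<Sum>i=0..l. mon (fact l) 0 (qprod_taylor e (l - i) x (qprod_taylor e i y z)))"
      by (intro sum.cong refl) (simp add: mon_mon coeff)
    finally show ?thesis
      by (simp add: mon_sum)
  qed
  have e': "set (replicate l e) \<subseteq> laurent_deg M 0"
    using e by auto
  have "mon (fact l) 0 (\<Sum>i=0..l. qprod_taylor e (l - i) (qprod_taylor e i x y) z)
      = mon (fact l) 0 (\<Sum>i=0..l. qprod_taylor e (l - i) x (qprod_taylor e i y z))"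
    unfolding left [symmetric] right [symmetric] using wdvv [OF e', of x y z] by simp
  from arg_cong [OF this, of "mon (inverse (fact l)) 0"] show ?thesis
    by (simp add: mon_mon)
qed

text \<open>
The derivation $q\partial_q$ hits the powers of $q$ in the structure constants, which by the divisor axiom amounts to inserting
$c_1(M)$, or one of the arguments. The $l$ bulk insertions and the first argument
are all equal to $e$, so they contribute $l+1$ equal terms.
\<close>

lemma qprod_taylor_divisor:
  assumes e: "e \<in> laurent_deg M 0"
  shows "q_deriv M (qprod_taylor e l e y) =
    mon (of_nat (Suc l)) 0 (qprod_taylor e (Suc l) (Poly_Mapping.single 0 (chern M)) y
      + qprod_taylor e l (q_deriv M e) y) + qprod_taylor e l e (q_deriv M y)"
proof -
  define c where "c = (Poly_Mapping.single 0 (chern M) :: 'v laurent)"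
  define u where "u = q_deriv M e"
  have u: "u \<in> laurent_deg M 0"
    using e by (simp add: u_def laurent_deg_q_deriv)
  have move: "qprod_list (x # e # y # S) = qprod_list (x # y # e # S)" for x S
    using qprod_list_swap [OF e, of "[x]" y S] by simp
  define h where "h i = qprod_list ((e # y # replicate l e)[i := q_deriv M ((e # y # replicate l e) ! i)])" for i
  have h_first: "h 0 = qprod_list (u # y # replicate l e)" "h 1 = qprod_list (e # q_deriv M y # replicate l e)"
    by (simp_all add: h_def u_def)
  \<comment> \<open>Moving the differentiated factor to the front needs even degree; then \<open>y\<close> passes the first \<open>e\<close>.\<close>
  have h_rest: "h i = qprod_list (u # y # replicate l e)" if i: "i \<in> {2..<Suc (Suc l)}" for i
  proof -
    obtain j where j: "i = Suc (Suc j)" "j < l"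
      using i by (cases i; cases "i - 1") auto
    have "(replicate l e)[j := u] = replicate j e @ u # replicate (l - Suc j) e"
      using j by (simp add: upd_conv_take_nth_drop)
    then have "h i = qprod_list ((e # y # replicate j e) @ u # replicate (l - Suc j) e)"
      using j by (simp add: h_def u_def)
    also have "\<dots> = qprod_list (u # e # y # replicate j e @ replicate (l - Suc j) e)"
      by (subst qprod_list_rotate [OF u]) simp_all
    also have "replicate j e @ replicate (l - Suc j) e = replicate (l - 1) e"
      using j by (simp add: replicate_add [symmetric])
    also have "qprod_list (u # e # y # replicate (l - 1) e) = qprod_list (u # y # replicate l e)"
      using j unfolding move by (cases l) auto
    finally show ?thesis .
  qed
  have "q_deriv M (qprod_list (e # y # replicate l e)) = qprod_list (c # e # y # replicate l e) + (\<Sum>i<Suc (Suc l). h i)"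
    using q_deriv_qprod_list [of "e # y # replicate l e"] by (simp add: c_def h_def del: sum.lessThan_Suc)
  also have "{..<Suc (Suc l)} = insert 0 (insert 1 {2..<Suc (Suc l)})"
    by auto
  also have "(\<Sum>i\<in>insert 0 (insert 1 {2..<Suc (Suc l)}). h i)
      = h 0 + (h 1 + (\<Sum>i\<in>{2..<Suc (Suc l)}. h i))"
    by (subst sum.insert; simp)+
  also have "(\<Sum>i\<in>{2..<Suc (Suc l)}. h i) = (\<Sum>i\<in>{2..<Suc (Suc l)}. qprod_list (u # y # replicate l e))"
    by (rule sum.cong [OF refl h_rest])
  also have "(\<Sum>i\<in>{2..<Suc (Suc l)}. qprod_list (u # y # replicate l e))
      = mon (of_nat l) 0 (qprod_list (u # y # replicate l e))"
    by (subst sum_const_mon) simp_all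
  also have "qprod_list (c # e # y # replicate l e) = qprod_list (c # y # replicate (Suc l) e)"
    by (simp add: move)
  finally have "q_deriv M (qprod_list (e # y # replicate l e)) = qprod_list (c # y # replicate (Suc l) e)
      + mon (of_nat (Suc l)) 0 (qprod_list (u # y # replicate l e)) + qprod_list (e # q_deriv M y # replicate l e)"
    by (simp add: h_first mon_add_left algebra_simps del: One_nat_def)
  then have "q_deriv M (qprod_taylor e l e y) = mon (inverse (fact l)) 0 (qprod_list (c # y # replicate (Suc l) e))
      + mon (of_nat (Suc l)) 0 (qprod_taylor e l u y) + qprod_taylor e l e (q_deriv M y)"
    by (simp add: qprod_taylor_def q_deriv_mon mon_add mon_commute [of "inverse (fact l)"] del: replicate_Suc of_nat_Suc)
  also have "mon (inverse (fact l)) 0 (qprod_list (c # y # replicate (Suc l) e))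
      = mon (of_nat (Suc l)) 0 (qprod_taylor e (Suc l) c y)"
    unfolding qprod_list_taylor mon_mon by (simp add: field_simps del: of_nat_Suc)
  finally show ?thesis
    by (simp add: mon_add c_def u_def del: of_nat_Suc)
qed

lemma qprod_taylor_0: "qprod_taylor e 0 x y = qmult M x y"
  by (simp add: qprod_taylor_def qmult_eq)

definition mult_op :: "'v laurent \<Rightarrow> 'v laurent \<Rightarrow> 'v laurent endo fps" where
  "mult_op e x = Abs_fps (\<lambda>l. endo_of (qprod_taylor e l x))"

lemma app_mult_op: "app (mult_op e x $ l) y = qprod_taylor e l x y"
  by (simp add: mult_op_def app_endo_of qprod_taylor_add)

lemma int_part_mult_op [simp]: "int_part (mult_op e x $ l) = 0"
  by (simp add: mult_op_def)

lemma mult_op_commute: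
  assumes e: "e \<in> laurent_deg M 0" and x: "x \<in> laurent_deg M d" "even d"
  shows "mult_op e e * mult_op e x = mult_op e x * mult_op e e"
proof (rule fps_ext, rule endo_eqI)
  fix l y
  let ?B = "qprod_taylor e"
  have rev: "(\<Sum>i=0..l. f i) = (\<Sum>i=0..l. f (l - i))" for f :: "nat \<Rightarrow> 'v laurent"
    using sum.nat_diff_reindex [of f "Suc l"] by (simp add: atLeast0AtMost lessThan_Suc_atMost)
  have app_mult: "app ((mult_op e v * mult_op e w) $ l) y = (\<Sum>i=0..l. ?B (l - i) v (?B i w y))" for v w
    unfolding fps_mult_nth app_fun_sum app_times app_mult_op by (subst rev) simp
  show "app ((mult_op e e * mult_op e x) $ l) y = app ((mult_op e x * mult_op e e) $ l) y"
    unfolding app_mult qprod_taylor_assoc [OF e, symmetric]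
    using qprod_taylor_commute [OF x] by simp
  show "int_part ((mult_op e e * mult_op e x) $ l) = int_part ((mult_op e x * mult_op e e) $ l)"
    by (simp add: fps_mult_nth int_part_sum)
qed

abbreviation c1 :: "'v laurent" where
  "c1 \<equiv> Poly_Mapping.single 0 (chern M)"

definition q_deriv_op :: "'v laurent endo" where
  "q_deriv_op = endo_of (q_deriv M)"

lemma app_q_deriv_op: "app q_deriv_op x = q_deriv M x"
  by (simp add: q_deriv_op_def app_endo_of q_deriv_add)

lemma c1_deg: "c1 \<in> laurent_deg M 2"
  using laurent_deg_single [of "chern M" 2 0] chern_coh by simp

text \<open>
The quantum connection as a polynomial in $t$ with operator coefficients.
\<close>

definition conn_op :: "'v laurent endo fps" where
  "conn_op = fps_const (endo_of (qmult M c1)) + fps_X * fps_const q_deriv_op"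

lemma qmult_add_right: "qmult M x (y + y') = qmult M x y + qmult M x y'"
  using qprod_taylor_add [of 0 0] by (simp add: qprod_taylor_0)

lemma act_conn_op: "act conn_op x = quantum_connection M x"
proof (rule fps_ext)
  fix k
  have X: "act (fps_X * F) x $ k = (if k = 0 then 0 else act F x $ (k - 1))" for F
  proof (cases k)
    case (Suc n)
    have "act (fps_X * F) x $ Suc n = (\<Sum>i=0..n. app (F $ i) (x $ (n - i)))"
      unfolding act_nth by (subst sum.atLeast0_atMost_Suc_shift) simp
    then show ?thesis
      by (simp add: Suc act_nth)
  qed (simp add: act_nth)
  have const: "act (fps_const f) x $ n = app f (x $ n)" for f n
    by (simp add: act_nth fps_const_def if_distrib [of "\<lambda>f. app f _"] sum.delta cong: if_cong)
  show "act conn_op x $ k = quantum_connection M x $ k"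
    by (simp add: conn_op_def act_plus X const app_q_deriv_op app_endo_of qmult_add_right quantum_connection_def)
qed

lemma mult_op_0: "mult_op e x $ 0 = endo_of (qmult M x)"
  by (rule endo_eqI) (simp_all add: app_mult_op qprod_taylor_0 app_endo_of qmult_add_right)

lemma mult_op_in_lin_ops:
  assumes e: "e \<in> laurent_deg M 0"
  shows "mult_op e e $ l \<in> lin_ops l"
proof -
  have "qprod_taylor e l e x \<in> laurent_deg M (d - 2 * int l)" if x: "x \<in> laurent_deg M d" for x d
  proof -
    have "list_all2 (\<lambda>x d. x \<in> laurent_deg M d) (replicate l e) (replicate l 0)"
      using e by (simp add: list_all2_conv_all_nth)
    then have "list_all2 (\<lambda>x d. x \<in> laurent_deg M d) (e # x # replicate l e) (0 # d # replicate l 0)"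
      using e x by simp
    from qprod_list_deg [OF this] have "qprod_list (e # x # replicate l e) \<in> laurent_deg M (d - 2 * int l)"
      by (simp add: sum_list_replicate)
    then show ?thesis
      using laurent_deg_mon [of _ _ _ 0] by (simp add: qprod_taylor_def)
  qed
  then show ?thesis
    by (simp add: lin_ops_def app_mult_op qprod_taylor_mon)
qed

text \<open>
The operators \<open>F\<close> and \<open>G\<close> are $e \ast_{se}$ and $(c_1(M) + s\, q\partial_q e) \ast_{se}$. The second is the
derivative of the bulk class $s e$ along $q\partial_q$, with $c_1(M)$ added, since $e$ itself depends on $q$.
\<close>

lemma flat_projector:
  assumes e: "e \<in> laurent_deg M 0" and ee: "qmult M e e = e"
  obtains P where "\<And>k. P $ k \<in> lin_ops k" "\<And>x. app (P $ 0) x = qmult M e x" "P * P = P"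
    "conn_op * P = P * conn_op * P"
proof -
  define u where "u = q_deriv M e"
  have u: "u \<in> laurent_deg M 0"
    using e by (simp add: u_def laurent_deg_q_deriv)
  define F where "F = mult_op e e"
  define G where "G = mult_op e c1 + fps_X * mult_op e u"
  have "F * G = G * F"
  proof -
    have "F * (fps_X * mult_op e u) = fps_X * (F * mult_op e u)"
      by (metis fps_mult_fps_X_commute mult.assoc)
    then show ?thesis
      using mult_op_commute [OF e c1_deg] mult_op_commute [OF e u]
      by (simp add: F_def G_def distrib_left distrib_right mult.assoc)
  qed
  moreover have "fps_deriv G + F * fps_const q_deriv_op = fps_const q_deriv_op * F"
  proof (rule fps_ext, rule endo_eqI)
    fix l x
    have "app (fps_deriv G $ l) x = mon (of_nat (Suc l)) 0 (qprod_taylor e (Suc l) c1 x + qprod_taylor e l u x)"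
    proof -
      have "fps_deriv G $ l = of_nat (Suc l) * (mult_op e c1 $ Suc l + mult_op e u $ l)"
        unfolding fps_deriv_nth by (simp add: G_def)
      then show ?thesis
        by (simp only: app_times app_of_nat app_plus app_mult_op)
    qed
    then show "app ((fps_deriv G + F * fps_const q_deriv_op) $ l) x = app ((fps_const q_deriv_op * F) $ l) x"
      using qprod_taylor_divisor [OF e, of l x]
      by (simp add: F_def u_def app_plus app_times app_mult_op app_q_deriv_op del: fps_deriv_nth of_nat_Suc)
    show "int_part ((fps_deriv G + F * fps_const q_deriv_op) $ l) = int_part ((fps_const q_deriv_op * F) $ l)"
      by (simp add: F_def G_def q_deriv_op_def)
  qed
  ultimately have flat: "t_deriv_s (const_t G + fps_const (fps_X * fps_const q_deriv_op))
      + const_t F * (const_t G + fps_const (fps_X * fps_const q_deriv_op))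
      = (const_t G + fps_const (fps_X * fps_const q_deriv_op)) * const_t F"
    by (rule flatness_from_coefficients)
  define T where "T = const_t G + fps_const (fps_X * fps_const q_deriv_op)"
  have T0: "T $ 0 = conn_op"
    by (simp add: T_def const_t_nth G_def mult_op_0 conn_op_def)
  \<comment> \<open>Quantum multiplication by \<open>e\<close>: the value at $s = 0$, around which the series is deformed.\<close>
  define \<epsilon> where "\<epsilon> = F $ 0"
  define a where "a = const_t F - fps_const (fps_const \<epsilon>)"
  have \<epsilon>_app: "app \<epsilon> x = qmult M e x" for x
    by (simp add: \<epsilon>_def F_def app_mult_op qprod_taylor_0)
  have "app (\<epsilon> * \<epsilon>) x = app \<epsilon> x" for x
    using qprod_taylor_assoc [OF e, of 0 e e x] by (simp add: app_times \<epsilon>_app qprod_taylor_0 ee)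
  then have "\<epsilon> * \<epsilon> = \<epsilon>"
    by (rule endo_eqI) (simp add: \<epsilon>_def F_def)
  moreover have "\<epsilon> \<in> lin_ops 0"
    unfolding \<epsilon>_def F_def by (rule mult_op_in_lin_ops [OF e])
  moreover have "ops.homogeneous a"
    unfolding ops.homogeneous_def a_def
    using mult_op_in_lin_ops [OF e] ops.zero_in ops.diff_in \<open>\<epsilon> \<in> lin_ops 0\<close>
    by (auto simp: const_t_nth F_def fps_const_def)
  moreover have "a $ 0 = 0"
    by (simp add: a_def const_t_nth \<epsilon>_def)
  ultimately obtain U where U: "ops.homogeneous U" "U $ 0 $ 0 = \<epsilon>"
    "U * fps_const (fps_const \<epsilon>) = U" "fps_const (fps_const \<epsilon>) * U = fps_const (fps_const \<epsilon>)"
    "t_deriv_s U + (fps_const (fps_const \<epsilon>) + a) * U = U * (fps_const (fps_const \<epsilon>) + a) * U"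
    by (rule ops.idempotent_deformation)
  have TU: "T * U = U * T * U"
  proof (rule deformed_idempotent_invariant [OF U(3,4) \<open>a $ 0 = 0\<close> U(5)])
    show "t_deriv_s T + (fps_const (fps_const \<epsilon>) + a) * T = T * (fps_const (fps_const \<epsilon>) + a)"
      using flat by (simp add: a_def T_def)
  qed
  have UU: "U * U = U"
    using U(3,4) by (metis mult.assoc)
  show thesis
  proof (rule that [of "U $ 0"])
    show "U $ 0 $ k \<in> lin_ops k" for k
      using U(1) unfolding ops.homogeneous_def by (metis add_0)
    show "app (U $ 0 $ 0) x = qmult M e x" for x
      by (simp add: U(2) \<epsilon>_app)
    show "U $ 0 * U $ 0 = U $ 0"
      using UU by (metis fps_mult_nth_0)
    show "conn_op * U $ 0 = U $ 0 * conn_op * U $ 0"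
      using TU T0 by (metis fps_mult_nth_0)
  qed
qed

section \<open>The graded completion\<close>

lemma completion_deg_act:
  assumes F: "\<And>k. F $ k \<in> lin_ops k" and x: "x \<in> completion_deg M d"
  shows "act F x \<in> completion_deg M d"
  unfolding completion_deg_def mem_Collect_eq act_nth
proof (intro allI laurent_deg_sum)
  fix k i :: nat
  assume i: "i \<in> {0..k}"
  have "x $ (k - i) \<in> laurent_deg M (d - 2 * int (k - i))"
    using x by (simp add: completion_deg_def)
  then have "app (F $ i) (x $ (k - i)) \<in> laurent_deg M (d - 2 * int (k - i) - 2 * int i)"
    using F [of i] by (simp add: lin_ops_def)
  moreover have "d - 2 * int (k - i) - 2 * int i = d - 2 * int k"
    using i by (simp add: of_nat_diff)
  ultimately show "app (F $ i) (x $ (k - i)) \<in> laurent_deg M (d - 2 * int k)"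
    by metis
qed

lemma completion_deg_conn: "x \<in> completion_deg M d \<Longrightarrow> quantum_connection M x \<in> completion_deg M (d + 2)"
  unfolding completion_deg_def quantum_connection_def mem_Collect_eq fps_nth_Abs_fps
proof (intro allI laurent_deg_add)
  fix k
  assume x: "\<forall>k. x $ k \<in> laurent_deg M (d - 2 * int k)"
  show "(if k = 0 then 0 else q_deriv M (x $ (k - 1))) \<in> laurent_deg M (d + 2 - 2 * int k)"
  proof (cases k)
    case (Suc n)
    have "q_deriv M (x $ n) \<in> laurent_deg M (d - 2 * int n)"
      using x laurent_deg_q_deriv by blast
    then show ?thesis
      by (simp add: Suc algebra_simps)
  qed (simp add: laurent_deg_0)
  have "qprod_list [c1, x $ k] \<in> laurent_deg M (sum_list [2, d - 2 * int k] - 2 * (int (length [c1, x $ k]) - 2))"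
    by (rule qprod_list_deg) (use x c1_deg in auto)
  moreover have "sum_list [2, d - 2 * int k] - 2 * (int (length [c1, x $ k]) - 2) = d + 2 - 2 * int k"
    by simp
  ultimately show "qmult M c1 (x $ k) \<in> laurent_deg M (d + 2 - 2 * int k)"
    unfolding qmult_eq by metis
qed

lemma completion_deg_0: "0 \<in> completion_deg M d"
  and completion_deg_add: "x \<in> completion_deg M d \<Longrightarrow> y \<in> completion_deg M d \<Longrightarrow> x + y \<in> completion_deg M d"
  by (simp_all add: completion_deg_def laurent_deg_0 laurent_deg_add)

lemma completion_0: "0 \<in> completion M"
  and completion_add: "x \<in> completion M \<Longrightarrow> y \<in> completion M \<Longrightarrow> x + y \<in> completion M"
  and completion_deg_subset: "x \<in> completion_deg M d \<Longrightarrow> x \<in> completion M"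
  unfolding completion_def
  by (auto intro: graded_sum_0 graded_sum_base graded_sum_add completion_deg_0 completion_deg_add)

lemma completion_sum: "(\<And>i. i \<in> I \<Longrightarrow> f i \<in> completion M) \<Longrightarrow> sum f I \<in> completion M"
  by (induction I rule: infinite_finite_induct) (auto simp: completion_0 completion_add)

lemma completionE:
  assumes "x \<in> completion M"
  obtains D y where "finite D" "\<And>d. d \<in> D \<Longrightarrow> y d \<in> completion_deg M d" "x = (\<Sum>d\<in>D. y d)"
  using assms unfolding completion_def graded_sum_def by blast

lemma completion_act:
  assumes "\<And>k. F $ k \<in> lin_ops k" and x: "x \<in> completion M"
  shows "act F x \<in> completion M"
proof -
  obtain D y where "finite D" "\<And>d. d \<in> D \<Longrightarrow> y d \<in> completion_deg M d" "x = (\<Sum>d\<in>D. y d)"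
    using x by (rule completionE) blast
  moreover from this have "act F (y d) \<in> completion M" if "d \<in> D" for d
    using completion_deg_act [OF assms(1)] completion_deg_subset that by blast
  ultimately show ?thesis
    by (simp add: act_sum completion_sum)
qed

lemma completion_conn:
  assumes x: "x \<in> completion M"
  shows "quantum_connection M x \<in> completion M"
proof -
  obtain D y where "finite D" "\<And>d. d \<in> D \<Longrightarrow> y d \<in> completion_deg M d" "x = (\<Sum>d\<in>D. y d)"
    using x by (rule completionE) blast
  moreover from this have "act conn_op (y d) \<in> completion M" if "d \<in> D" for d
    using completion_deg_conn completion_deg_subset that unfolding act_conn_op by blast
  ultimately show ?thesis
    unfolding act_conn_op [symmetric] by (simp add: act_sum completion_sum)
qed

lemma constant_in_completion: "fps_const v \<in> completion M" for v :: "'v laurent"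
  using add_span_monomials [of v]
proof (induction rule: add_span.induct)
  case zero
  then show ?case by (simp add: completion_0)
next
  case (add x y)
  then obtain d where "x \<in> laurent_deg M d"
    using monomials_subset by blast
  then have "fps_const x \<in> completion_deg M d"
    by (auto simp: completion_deg_def laurent_deg_0)
  then have "fps_const x + fps_const y \<in> completion M"
    using add.IH by (intro completion_add) (auto intro: completion_deg_subset)
  then show ?case by simp
qed

section \<open>The invariant splitting\<close>

lemma laurent_scale_add: "laurent_scale M a (x + y) = laurent_scale M a x + laurent_scale M a y"
  by (simp add: laurent_scale_mon mon_add sum.distrib)

lemma completion_scale_act:
  "completion_scale M r x = act (Abs_fps (\<lambda>i. endo_of (laurent_scale M (r $ i)))) x"
  by (rule fps_ext)
    (simp add: completion_scale_def act_nth app_endo_of laurent_scale_add atLeast0AtMost)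

text \<open>
Scalars act as a series of operators too, and these commute with the coefficients of \<open>F\<close>.
\<close>

lemma completion_scale_commute:
  assumes "\<And>k. F $ k \<in> lin_ops k"
  shows "completion_scale M r (act F x) = act F (completion_scale M r x)"
proof -
  have "app (F $ j) (laurent_scale M a x) = laurent_scale M a (app (F $ j) x)" for j a x
    using assms [of j] by (simp add: lin_ops_def laurent_scale_mon app_sum)
  then show ?thesis
    unfolding completion_scale_act by (intro act_commute) (simp add: app_endo_of laurent_scale_add)
qed

lemma completion_scale_deg:
  assumes r: "r \<in> coeff_deg d" and x: "x \<in> completion_deg M d'"
  shows "completion_scale M r x \<in> completion_deg M (d + d')"
  unfolding completion_deg_def mem_Collect_eq completion_scale_def fps_nth_Abs_fps laurent_scale_mon
proof (intro allI laurent_deg_sum)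
  fix k i j
  assume i: "i \<in> {..k}" and j: "j \<in> Poly_Mapping.keys (r $ i)"
  have "x $ (k - i) \<in> laurent_deg M (d' - 2 * int (k - i))"
    using x by (simp add: completion_deg_def)
  then have "mon (Poly_Mapping.lookup (r $ i) j) j (x $ (k - i)) \<in> laurent_deg M (d' - 2 * int (k - i) + 2 * j)"
    by (rule laurent_deg_mon)
  moreover have "2 * j + 2 * int i = d"
    using r j by (auto simp: coeff_deg_def)
  then have "d' - 2 * int (k - i) + 2 * j = d + d' - 2 * int k"
    using i by (simp add: of_nat_diff)
  ultimately show "mon (Poly_Mapping.lookup (r $ i) j) j (x $ (k - i)) \<in> laurent_deg M (d + d' - 2 * int k)"
    by metis
qed

lemma completion_scale_add_left: "completion_scale M (r + r') x = completion_scale M r x + completion_scale M r' x"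
proof (rule fps_ext)
  fix k
  have "laurent_scale M (a + b) y = laurent_scale M a y + laurent_scale M b y" for a b y
    unfolding laurent_scale_mon by (rule setsum_keys_plus_distrib) (simp_all add: mon_add_left)
  then show "completion_scale M (r + r') x $ k = (completion_scale M r x + completion_scale M r' x) $ k"
    by (simp add: completion_scale_def sum.distrib)
qed

lemma completion_scale_0_left: "completion_scale M 0 x = 0"
  using completion_scale_add_left [of 0 0 x] by simp

lemma completion_scale_sum_left: "completion_scale M (sum r I) x = (\<Sum>i\<in>I. completion_scale M (r i) x)"
  by (induction I rule: infinite_finite_induct) (auto simp: completion_scale_add_left completion_scale_0_left)

lemma completion_scale_sum: "completion_scale M r (sum x I) = (\<Sum>i\<in>I. completion_scale M r (x i))"
  by (simp add: completion_scale_act act_sum)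

lemma completion_scale_closed:
  assumes "r \<in> coeff_ring" "x \<in> completion M"
  shows "completion_scale M r x \<in> completion M"
proof -
  obtain D s where s: "\<And>d. d \<in> D \<Longrightarrow> s d \<in> coeff_deg d" "r = (\<Sum>d\<in>D. s d)"
    using assms(1) unfolding coeff_ring_def graded_sum_def by blast
  obtain D' y where y: "\<And>d. d \<in> D' \<Longrightarrow> y d \<in> completion_deg M d" "x = (\<Sum>d\<in>D'. y d)"
    using assms(2) by (rule completionE) blast
  have "completion_scale M (s d) (y d') \<in> completion M" if "d \<in> D" "d' \<in> D'" for d d'
    using completion_scale_deg [OF s(1) y(1)] that completion_deg_subset by blast
  then show ?thesis
    unfolding s(2) y(2) completion_scale_sum completion_scale_sum_left by (intro completion_sum)
qed

lemma graded_submodule_image: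
  assumes P: "\<And>k. P $ k \<in> lin_ops k"
  shows "graded_submodule M (act P ` completion M)"
proof -
  define W where "W = act P ` completion M"
  have zero: "0 \<in> W"
    unfolding W_def using completion_0 act_0 by (metis imageI)
  have add: "x + y \<in> W" if "x \<in> W" "y \<in> W" for x y
    using that completion_add by (auto simp: W_def act_add [symmetric])
  have scale: "completion_scale M r x \<in> W" if "r \<in> coeff_ring" "x \<in> W" for r x
    using that completion_scale_closed by (auto simp: W_def completion_scale_commute [OF P])
  have "x \<in> graded_sum (\<lambda>d. W \<inter> completion_deg M d)" if x: "x \<in> W" for x
  proof -
    obtain y where y: "y \<in> completion M" "x = act P y"
      using x unfolding W_def by blast
    obtain D f where f: "finite D" "\<And>d. d \<in> D \<Longrightarrow> f d \<in> completion_deg M d" "y = (\<Sum>d\<in>D. f d)"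
      using y(1) by (rule completionE) blast
    have "act P (f d) \<in> W \<inter> completion_deg M d" if "d \<in> D" for d
      unfolding W_def using f(2) [OF that] completion_deg_subset completion_deg_act [OF P] by blast
    moreover have "x = (\<Sum>d\<in>D. act P (f d))"
      by (simp add: y f act_sum)
    ultimately show ?thesis
      unfolding graded_sum_def using f(1)
      by (intro CollectI exI [of _ D] exI [of _ "\<lambda>d. act P (f d)"]) simp
  qed
  moreover have "x \<in> W" if x: "x \<in> graded_sum (\<lambda>d. W \<inter> completion_deg M d)" for x
  proof -
    obtain D f where f: "finite D" "\<forall>d\<in>D. f d \<in> W \<inter> completion_deg M d" "x = (\<Sum>d\<in>D. f d)"
      using x unfolding graded_sum_def mem_Collect_eq by (elim exE conjE)
    from f(1,2) have "(\<Sum>d\<in>D. f d) \<in> W"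
      by (induction D rule: finite_induct) (auto simp: zero add)
    then show ?thesis
      by (simp add: f(3))
  qed
  ultimately have "W = graded_sum (\<lambda>d. W \<inter> completion_deg M d)"
    by blast
  then show ?thesis
    unfolding graded_submodule_def W_def [symmetric] using zero add scale by simp
qed

lemma qmult_assoc: "e \<in> laurent_deg M 0 \<Longrightarrow> qmult M (qmult M x y) z = qmult M x (qmult M y z)"
  using qprod_taylor_assoc [of e 0 x y z] by (simp add: qprod_taylor_0)

lemma qmult_0_left [simp]: "qmult M 0 x = 0"
  and qmult_0_right [simp]: "qmult M x 0 = 0"
  by (simp_all add: qmult_def)

lemma qmult_sum_left: "qmult M (sum f I) x = (\<Sum>i\<in>I. qmult M (f i) x)"
  using qprod_taylor_add_left [of 0 0]
  by (induction I rule: infinite_finite_induct) (auto simp: qprod_taylor_0)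

lemma qmult_sum_right: "qmult M x (sum f I) = (\<Sum>i\<in>I. qmult M x (f i))"
  by (induction I rule: infinite_finite_induct) (auto simp: qmult_add_right)

lemma right_inverse_in_lin_ops:
  assumes F: "\<And>k. F $ k \<in> lin_ops k"
  shows "fps_right_inverse F 1 $ n \<in> lin_ops n"
proof (induction n rule: less_induct)
  case (less n)
  show ?case
  proof (cases n)
    case 0
    then show ?thesis
      using ops.one_in by simp
  next
    case (Suc k)
    have "F $ i * fps_right_inverse_constructor F 1 (n - i) \<in> lin_ops n" if "i \<in> {1..n}" for i
    proof -
      have "fps_right_inverse_constructor F 1 (n - i) \<in> lin_ops (n - i)"
        using less.IH [of "n - i"] that by simp
      then have "F $ i * fps_right_inverse_constructor F 1 (n - i) \<in> lin_ops (i + (n - i))"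
        by (rule ops.mult_in [OF F])
      then show ?thesis
        using that by simp
    qed
    then have "- (\<Sum>i=1..n. F $ i * fps_right_inverse_constructor F 1 (n - i)) \<in> lin_ops n"
      by (intro ops.uminus_in ops.sum_in)
    then show ?thesis
      by (simp add: Suc)
  qed
qed

lemma invariant_splitting:
  assumes e: "idempotent_decomposition M m e"
  shows "\<exists>W. graded_splitting M m W \<and>
           (\<forall>i<m. \<forall>x\<in>W i. quantum_connection M x \<in> W i) \<and>
           (\<forall>i<m. (\<lambda>x. fps_nth x 0) ` W i = range (qmult M (e i)))"
proof -
  have e_deg: "e i \<in> laurent_deg M 0" and e_idem: "qmult M (e i) (e i) = e i" if "i < m" for i
    using e that by (auto simp: idempotent_decomposition_def)
  have e_orth: "qmult M (e i) (e j) = 0" if "i < m" "j < m" "i \<noteq> j" for i j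
    using e that by (auto simp: idempotent_decomposition_def)
  have e_sum: "(\<Sum>i<m. qmult M (e i) x) = x" for x
    using e qprod_list_unit [of x] unfolding qmult_sum_left [symmetric]
    by (simp add: idempotent_decomposition_def qmult_eq)
  have "\<forall>i. \<exists>P. i < m \<longrightarrow> (\<forall>k. P $ k \<in> lin_ops k) \<and> (\<forall>x. app (P $ 0) x = qmult M (e i) x) \<and> P * P = P
      \<and> conn_op * P = P * conn_op * P"
    using flat_projector [OF e_deg e_idem] by metis
  then obtain P where P: "\<And>i k. i < m \<Longrightarrow> P i $ k \<in> lin_ops k"
    "\<And>i x. i < m \<Longrightarrow> app (P i $ 0) x = qmult M (e i) x"
    "\<And>i. i < m \<Longrightarrow> P i * P i = P i"
    "\<And>i. i < m \<Longrightarrow> conn_op * P i = P i * conn_op * P i"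
    by metis
  define W where "W i = act (P i) ` completion M" for i
  have W_fixed: "act (P i) w = w" if "i < m" "w \<in> W i" for i w
    using that P(3) by (auto simp: W_def act_mult [symmetric])
  \<comment> \<open>The constant term of the sum of the \<open>P i\<close> acts as the identity, but its integer component is 0;
    the unit of the ring is put in its place.\<close>
  define \<Phi> where "\<Phi> = Abs_fps (\<lambda>k. if k = 0 then 1 else \<Sum>i<m. P i $ k)"
  have act_\<Phi>: "act \<Phi> x = (\<Sum>i<m. act (P i) x)" for x
  proof -
    have "act \<Phi> x = act (\<Sum>i<m. P i) x"
      by (rule act_cong) (simp add: \<Phi>_def fps_sum_nth app_fun_sum P(2) e_sum)
    then show ?thesis
      by (simp add: act_fun_sum)
  qed
  have \<Phi>_ops: "\<Phi> $ k \<in> lin_ops k" for k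
    using P(1) ops.one_in by (auto simp: \<Phi>_def intro!: ops.sum_in)
  define \<Psi> where "\<Psi> = fps_right_inverse \<Phi> 1"
  have "\<Phi> * \<Psi> = 1"
    unfolding \<Psi>_def by (rule fps_right_inverse) (simp add: \<Phi>_def)
  have \<Psi>_ops: "\<Psi> $ k \<in> lin_ops k" for k
    unfolding \<Psi>_def using \<Phi>_ops by (rule right_inverse_in_lin_ops)
  have "graded_splitting M m W"
    unfolding graded_splitting_def
  proof (intro conjI allI impI ballI)
    fix i
    assume "i < m"
    then show "graded_submodule M (W i)"
      unfolding W_def using P(1) by (intro graded_submodule_image)
  next
    fix x
    assume x: "x \<in> completion M"
    show "\<exists>!w. (\<forall>i<m. w i \<in> W i) \<and> (\<forall>i\<ge>m. w i = 0) \<and> x = (\<Sum>i<m. w i)"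
    proof (rule ex_ex1I)
      have "x = (\<Sum>i<m. act (P i) (act \<Psi> x))"
        using arg_cong [OF \<open>\<Phi> * \<Psi> = 1\<close>, of "\<lambda>F. act F x"] by (simp add: act_mult act_\<Phi>)
      moreover have "act (P i) (act \<Psi> x) \<in> W i" for i
        unfolding W_def using completion_act [OF \<Psi>_ops x] by blast
      ultimately show "\<exists>w. (\<forall>i<m. w i \<in> W i) \<and> (\<forall>i\<ge>m. w i = 0) \<and> x = (\<Sum>i<m. w i)"
        by (intro exI [of _ "\<lambda>i. if i < m then act (P i) (act \<Psi> x) else 0"]) simp
    next
      fix w w'
      assume w: "(\<forall>i<m. w i \<in> W i) \<and> (\<forall>i\<ge>m. w i = 0) \<and> x = (\<Sum>i<m. w i)"
        and w': "(\<forall>i<m. w' i \<in> W i) \<and> (\<forall>i\<ge>m. w' i = 0) \<and> x = (\<Sum>i<m. w' i)"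
      define v where "v i = w i - w' i" for i
      have v_fixed: "act (P i) (v i) = v i" if "i < m" for i
        using w w' W_fixed that by (simp add: v_def act_diff)
      have v_sum: "(\<Sum>i<m. v i) = 0"
        using w w' by (simp add: v_def sum_subtractf)
      \<comment> \<open>In the lowest order in $t$ that is left, the projector \<open>P i\<close> acts as multiplication by \<open>e i\<close>.\<close>
      have v0: "\<forall>i<m. v i $ k = 0" for k
      proof (induction k rule: less_induct)
        case (less k)
        have eig: "qmult M (e i) (v i $ k) = v i $ k" if i: "i < m" for i
        proof -
          have "v i $ k = (\<Sum>j=0..k. app (P i $ j) (v i $ (k - j)))"
            using v_fixed [OF i] by (metis act_nth)
          also have "\<dots> = (\<Sum>j=0..k. if j = 0 then app (P i $ 0) (v i $ k) else 0)"
            using less.IH i by (intro sum.cong) auto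
          also have "\<dots> = qmult M (e i) (v i $ k)"
            using P(2) i by simp
          finally show ?thesis by simp
        qed
        show ?case
        proof (intro allI impI)
          fix j
          assume j: "j < m"
          have "0 = qmult M (e j) (\<Sum>i<m. v i $ k)"
            using arg_cong [OF v_sum, of "\<lambda>x. x $ k"] by (simp add: fps_sum_nth)
          also have "\<dots> = (\<Sum>i<m. if i = j then v j $ k else 0)"
          proof -
            have "qmult M (e j) (v i $ k) = (if i = j then v j $ k else 0)" if i: "i < m" for i
            proof (cases "i = j")
              case False
              have "qmult M (e j) (v i $ k) = qmult M (qmult M (e j) (e i)) (v i $ k)"
                unfolding qmult_assoc [OF e_deg [OF j]] eig [OF i] ..
              then show ?thesis
                using e_orth [OF j i] False by simp
            qed (use eig j in simp)
            then show ?thesis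
              by (simp add: qmult_sum_right)
          qed
          also have "\<dots> = v j $ k"
            using j by simp
          finally show "v j $ k = 0" by simp
        qed
      qed
      show "w = w'"
      proof
        fix i
        show "w i = w' i"
        proof (cases "i < m")
          case True
          then have "v i = 0"
            using v0 by (intro fps_ext) simp
          then show ?thesis by (simp add: v_def)
        qed (use w w' in auto)
      qed
    qed
  qed
  moreover have "quantum_connection M x \<in> W i" if i: "i < m" and x: "x \<in> W i" for i x
  proof -
    obtain y where y: "y \<in> completion M" "x = act (P i) y"
      using x unfolding W_def by blast
    have "quantum_connection M x = act (conn_op * P i) y"
      by (simp add: y act_conn_op [symmetric] act_mult)
    also have "\<dots> = act (P i) (quantum_connection M (act (P i) y))"
      unfolding P(4) [OF i] by (simp add: act_conn_op [symmetric] act_mult)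
    finally show ?thesis
      unfolding W_def using completion_conn completion_act P(1) i y(1) by blast
  qed
  moreover have "(\<lambda>x. x $ 0) ` W i = range (qmult M (e i))" if i: "i < m" for i
  proof -
    have act0: "act (P i) y $ 0 = qmult M (e i) (y $ 0)" for y
      using P(2) i by (simp add: act_nth)
    have "qmult M (e i) v \<in> (\<lambda>x. x $ 0) ` W i" for v
      unfolding W_def image_image act0 
      by (rule image_eqI [where x = "fps_const v"]) (simp_all add: constant_in_completion)
    then show ?thesis
      unfolding W_def image_image act0 by auto
  qed
  ultimately show ?thesis
    by blast
qed

end

theorem mainTheorem4:
  fixes M :: "('v::ab_group_add, 'h::ab_group_add) gw_data"
    and m :: nat and e :: "nat \<Rightarrow> 'v laurent"
  assumes "closed_monotone_symplectic M"
    and "maximal_idempotent_decomposition M m e"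
  shows "\<exists>W. graded_splitting M m W \<and>
           (\<forall>i<m. \<forall>x\<in>W i. quantum_connection M x \<in> W i) \<and>
           (\<forall>i<m. (\<lambda>x. fps_nth x 0) ` W i = range (qmult M (e i)))"
proof -
  interpret monotone_gw M
    by unfold_locales (rule assms)
  show ?thesis
    using assms(2) invariant_splitting by (simp add: maximal_idempotent_decomposition_def)
qed

end
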